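(* Let $p\ge 1$ be an integer. Let $\emptyset\neq K\subset\mathbb{R}^m$ be a compact set and let $f,g:K\to\mathbb{R}$ be two definable functions. Assume that $g$ is continuous and that $f^{-1}(0)^{\gamma}\subset g^{-1}(0)$. Then there exists a definable $\phi\in\Phi_p$ such that $|\phi(g(x))|\le |f(x)|$ for all $x\in K$.
   Context: Definable means definable in a fixed o-minimal structure on the real field $(\mathbb{R},+,\cdot)$ (a structure containing all real algebraic sets, whose definable subsets of $\mathbb{R}$ are exactly the finite unions of points and intervals). A function is definable if its graph is a definable set (hence its domain is definable). For a function $f:A\to\mathbb{R}$, $A\subset\mathbb{R}^m$, the generalized set of zeroes is $f^{-1}(0)^{\gamma}:=\pi(\overline{\Gamma_f}\cap(\mathbb{R}^m\times\{0\}))$, where $\Gamma_f$ is the graph of $f$ and $\pi:\mathbb{R}^m\times\mathbb{R}\to\mathbb{R}^m$ is the natural projection; equivalently, $x_0\in f^{-1}(0)^{\gamma}$ iff there is a sequence $x_\nu\in A$ with $x_\nu\to x_0$ and $f(x_\nu)\to 0$. $\Phi_p$ is the set of all odd, increasing bijections $\phi:\mathbb{R}\to\mathbb{R}$ of class $\mathcal{C}^p$ with $\phi^{(k)}(0)=0$ for $k\in\{1,\dots,p\}$. *)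

theory Defs
  imports "HOL-Analysis.Analysis"
begin

text \<open>
  A point of \<open>\<real>\<^sup>n\<close> is a function \<open>nat \<Rightarrow> real\<close> that is \<open>undefined\<close> outside \<open>{..<n}\<close>, so that
  the dimension can be quantified over inside a formula.  With the product topology of the type
  \<open>nat \<Rightarrow> real\<close>, the closed subspace \<open>euclid n\<close> is homeomorphic to Euclidean \<open>n\<close>-space; hence
  \<^const>\<open>compact\<close>, \<^const>\<open>closure\<close> and \<^const>\<open>continuous_on\<close> have their usual meaning for its subsets.
\<close>

definition euclid :: "nat \<Rightarrow> (nat \<Rightarrow> real) set" where
  "euclid n = ({..<n} \<rightarrow>\<^sub>E UNIV)"

inductive poly_fun :: "nat \<Rightarrow> ((nat \<Rightarrow> real) \<Rightarrow> real) \<Rightarrow> bool" for n :: nat where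
  const: "poly_fun n (\<lambda>x. c)"
| coord: "i < n \<Longrightarrow> poly_fun n (\<lambda>x. x i)"
| add: "poly_fun n p \<Longrightarrow> poly_fun n q \<Longrightarrow> poly_fun n (\<lambda>x. p x + q x)"
| mult: "poly_fun n p \<Longrightarrow> poly_fun n q \<Longrightarrow> poly_fun n (\<lambda>x. p x * q x)"

definition algebraic_set :: "nat \<Rightarrow> (nat \<Rightarrow> real) set \<Rightarrow> bool" where
  "algebraic_set n A \<longleftrightarrow>
    (\<exists>P. finite P \<and> (\<forall>p\<in>P. poly_fun n p) \<and> A = {x \<in> euclid n. \<forall>p\<in>P. p x = 0})"

text \<open>
  \<open>S n\<close> is the collection of definable subsets of \<open>\<real>\<^sup>n\<close>.  For \<open>x \<in> \<real>\<^sup>n\<close>, the points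
  \<open>(x, t)\<close> and \<open>(t, x)\<close> of \<open>\<real>\<^sup>n\<^sup>+\<^sup>1\<close> are \<open>x(n := t)\<close> and \<open>case_nat t x\<close>, and restriction to
  \<open>{..<n}\<close> is the projection \<open>\<real>\<^sup>n\<^sup>+\<^sup>1 \<rightarrow> \<real>\<^sup>n\<close> onto the first \<open>n\<close> coordinates.
\<close>

locale real_field_structure =
  fixes S :: "nat \<Rightarrow> (nat \<Rightarrow> real) set set"
  assumes subset_euclid: "A \<in> S n \<Longrightarrow> A \<subseteq> euclid n"
    and Un_closed: "A \<in> S n \<Longrightarrow> B \<in> S n \<Longrightarrow> A \<union> B \<in> S n"
    and compl_closed: "A \<in> S n \<Longrightarrow> euclid n - A \<in> S n"
    and times_line: "A \<in> S n \<Longrightarrow> {x(n := t) | x t. x \<in> A} \<in> S (Suc n)"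
    and line_times: "A \<in> S n \<Longrightarrow> {case_nat t x | t x. x \<in> A} \<in> S (Suc n)"
    and proj_closed: "A \<in> S (Suc n) \<Longrightarrow> (\<lambda>x. restrict x {..<n}) ` A \<in> S n"
    and algebraic: "algebraic_set n A \<Longrightarrow> A \<in> S n"

text \<open>Note that \<^const>\<open>is_interval\<close> holds of the empty set, of points, and of bounded and
  unbounded intervals with or without their endpoints.\<close>

locale o_minimal_structure = real_field_structure +
  assumes o_minimal:
    "A \<in> S 1 \<longleftrightarrow> A \<subseteq> euclid 1 \<and>
      (\<exists>\<J>. finite \<J> \<and> (\<forall>J\<in>\<J>. is_interval J) \<and> (\<lambda>x. x 0) ` A = \<Union>\<J>)"

definition definable_fun ::
  "(nat \<Rightarrow> (nat \<Rightarrow> real) set set) \<Rightarrow> nat \<Rightarrow> (nat \<Rightarrow> real) set \<Rightarrow> ((nat \<Rightarrow> real) \<Rightarrow> real) \<Rightarrow> bool" where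
  "definable_fun S m A f \<longleftrightarrow> A \<subseteq> euclid m \<and> {x(m := f x) | x. x \<in> A} \<in> S (Suc m)"

definition definable_real_fun :: "(nat \<Rightarrow> (nat \<Rightarrow> real) set set) \<Rightarrow> (real \<Rightarrow> real) \<Rightarrow> bool" where
  "definable_real_fun S \<phi> \<longleftrightarrow> definable_fun S 1 (euclid 1) (\<lambda>x. \<phi> (x 0))"

definition gen_zeros :: "(nat \<Rightarrow> real) set \<Rightarrow> ((nat \<Rightarrow> real) \<Rightarrow> real) \<Rightarrow> (nat \<Rightarrow> real) set" where
  "gen_zeros A f = fst ` (closure {(x, f x) | x. x \<in> A} \<inter> UNIV \<times> {0})"

definition class_C :: "nat \<Rightarrow> (real \<Rightarrow> real) \<Rightarrow> bool" where
  "class_C p \<phi> \<longleftrightarrow>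
    (\<forall>k<p. \<forall>x. (deriv ^^ k) \<phi> differentiable (at x)) \<and> continuous_on UNIV ((deriv ^^ p) \<phi>)"

definition Phi :: "nat \<Rightarrow> (real \<Rightarrow> real) set" where
  "Phi p = {\<phi>. (\<forall>x. \<phi> (- x) = - \<phi> x) \<and> strict_mono \<phi> \<and> bij \<phi> \<and> class_C p \<phi> \<and>
                (\<forall>k\<in>{1..p}. (deriv ^^ k) \<phi> 0 = 0)}"

end

theory Submission
  imports Defs
begin

section \<open>Definable predicates and terms\<close>

text \<open>
  Let \<open>h t\<close> be the infimum of \<open>1\<close> and of \<open>\<bar>f x\<bar>\<close> over \<open>{x \<in> K. t \<le> \<bar>g x\<bar>}\<close>.  It is definable and
  nondecreasing, and compactness together with the hypothesis on the generalized zeroes makes it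
  positive for \<open>t > 0\<close>, so it suffices to find a definable function of class \<open>\<Phi>\<^sub>p\<close> below \<open>h\<close>.

  If \<open>w\<close> is definable with limit \<open>0\<close> at \<open>0\<^sup>+\<close>, then it is differentiable near \<open>0\<^sup>+\<close>, and \<open>\<bar>w'\<bar>\<close> is
  monotone there, whence \<open>t w'(t) \<rightarrow> 0\<close> by the mean value theorem.  As
  \<open>(t\<^sup>k w)' = t\<^sup>k\<^sup>-\<^sup>1 (k w + t w')\<close> has the same shape, \<open>t\<^sup>p w\<close> is \<open>p\<close>-flat at \<open>0\<close> by induction.  Taking
  \<open>w t = t h t\<close> gives the minorant on some \<open>(0, e)\<close>; it is made global by substituting a bounded
  semialgebraic diffeomorphism \<open>\<sigma>\<close> onto an open interval with \<open>\<sigma> t \<le> t\<close> and made unbounded by a factor \<open>c (1 + t\<^sup>2)\<close> that is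
  at most \<open>1\<close> on the range of \<open>\<bar>g\<bar>\<close>.
\<close>

lemma euclid_iff: "x \<in> euclid n \<longleftrightarrow> (\<forall>i\<ge>n. x i = undefined)"
  by (force simp: euclid_def PiE_iff extensional_def)

lemma restrict_in_euclid: "restrict x {..<n} \<in> euclid n"
  by (simp add: euclid_iff)

definition depends :: "nat \<Rightarrow> ((nat \<Rightarrow> real) \<Rightarrow> 'b) \<Rightarrow> bool" where
  "depends n F \<longleftrightarrow> (\<forall>x y. (\<forall>i<n. x i = y i) \<longrightarrow> F x = F y)"

lemma dependsD: "depends n F \<Longrightarrow> (\<And>i. i < n \<Longrightarrow> x i = y i) \<Longrightarrow> F x = F y"
  by (auto simp: depends_def)

lemma depends_mono: "depends n F \<Longrightarrow> n \<le> m \<Longrightarrow> depends m F"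
  unfolding depends_def by (meson less_le_trans)

lemma depends_fun_upd: "depends n F \<Longrightarrow> n \<le> i \<Longrightarrow> F (x(i := t)) = F x"
  by (rule dependsD) auto

lemma poly_fun_depends: "poly_fun n p \<Longrightarrow> depends n p"
proof (induction rule: poly_fun.induct)
  case (add p q)
  then show ?case by (auto simp: depends_def intro!: arg_cong2[where f = "(+)"])
next
  case (mult p q)
  then show ?case by (auto simp: depends_def intro!: arg_cong2[where f = "(*)"])
qed (auto simp: depends_def)

lemma poly_fun_diff: "poly_fun n p \<Longrightarrow> poly_fun n q \<Longrightarrow> poly_fun n (\<lambda>x. p x - q x)"
  using poly_fun.add[OF _ poly_fun.mult[OF poly_fun.const[of n "-1"]]] by simp

lemmas poly_fun_intros = poly_fun.const poly_fun.coord poly_fun.add poly_fun.mult poly_fun_diff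

section \<open>Connectives, quantifiers and renaming of variables\<close>

context real_field_structure
begin

text \<open>
  Predicates and terms take an unrestricted assignment \<open>nat \<Rightarrow> real\<close> of which only the first \<open>n\<close>
  values matter; a quantifier over the coordinate \<open>x n\<close> passes from \<open>Suc n\<close> to \<open>n\<close> variables.
\<close>

definition def_pred :: "nat \<Rightarrow> ((nat \<Rightarrow> real) \<Rightarrow> bool) \<Rightarrow> bool" where
  "def_pred n P \<longleftrightarrow> depends n P \<and> {x \<in> euclid n. P x} \<in> S n"

definition def_term :: "nat \<Rightarrow> ((nat \<Rightarrow> real) \<Rightarrow> real) \<Rightarrow> bool" where
  "def_term n F \<longleftrightarrow> depends n F \<and> def_pred (Suc n) (\<lambda>x. x n = F x)"

lemma def_pred_depends: "def_pred n P \<Longrightarrow> depends n P"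
  by (simp add: def_pred_def)

lemma def_pred_not:
  assumes "def_pred n P" shows "def_pred n (\<lambda>x. \<not> P x)"
proof -
  have "{x \<in> euclid n. \<not> P x} = euclid n - {x \<in> euclid n. P x}" by auto
  then have "{x \<in> euclid n. \<not> P x} \<in> S n"
    using assms compl_closed[of "{x \<in> euclid n. P x}" n] by (simp only: def_pred_def)
  moreover have "depends n (\<lambda>x. \<not> P x)"
    unfolding depends_def
  proof (intro allI impI)
    fix x y :: "nat \<Rightarrow> real" assume "\<forall>i<n. x i = y i"
    then have "P x = P y" by (intro dependsD[OF def_pred_depends[OF assms]]) simp
    then show "(\<not> P x) = (\<not> P y)" by simp
  qed
  ultimately show ?thesis by (simp add: def_pred_def)
qed

lemma def_pred_disj:
  assumes "def_pred n P" "def_pred n Q" shows "def_pred n (\<lambda>x. P x \<or> Q x)"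
proof -
  have "{x \<in> euclid n. P x \<or> Q x} = {x \<in> euclid n. P x} \<union> {x \<in> euclid n. Q x}" by auto
  then have "{x \<in> euclid n. P x \<or> Q x} \<in> S n"
    using assms Un_closed[of "{x \<in> euclid n. P x}" n "{x \<in> euclid n. Q x}"] by (simp only: def_pred_def)
  moreover have "depends n (\<lambda>x. P x \<or> Q x)"
    unfolding depends_def
  proof (intro allI impI)
    fix x y :: "nat \<Rightarrow> real" assume xy: "\<forall>i<n. x i = y i"
    have "P x = P y" by (intro dependsD[OF def_pred_depends[OF assms(1)]]) (simp add: xy)
    moreover have "Q x = Q y" by (intro dependsD[OF def_pred_depends[OF assms(2)]]) (simp add: xy)
    ultimately show "(P x \<or> Q x) = (P y \<or> Q y)" by simp
  qed
  ultimately show ?thesis by (simp add: def_pred_def)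
qed

lemma def_pred_conj: "def_pred n P \<Longrightarrow> def_pred n Q \<Longrightarrow> def_pred n (\<lambda>x. P x \<and> Q x)"
  using def_pred_not[OF def_pred_disj[OF def_pred_not def_pred_not], of n P Q] by simp

lemma def_pred_imp: "def_pred n P \<Longrightarrow> def_pred n Q \<Longrightarrow> def_pred n (\<lambda>x. P x \<longrightarrow> Q x)"
  using def_pred_disj[OF def_pred_not, of n P Q] by simp

lemma def_pred_poly:
  assumes "finite I" "\<And>p. p \<in> I \<Longrightarrow> poly_fun n p"
  shows "def_pred n (\<lambda>x. \<forall>p\<in>I. p x = 0)"
proof -
  have "depends n (\<lambda>x. \<forall>p\<in>I. p x = 0)"
    unfolding depends_def
  proof (intro allI impI)
    fix x y :: "nat \<Rightarrow> real" assume "\<forall>i<n. x i = y i"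
    then have "(p x = 0) = (p y = 0)" if "p \<in> I" for p
      using dependsD[OF poly_fun_depends[OF assms(2)[OF that]], of x y] by simp
    then show "(\<forall>p\<in>I. p x = 0) = (\<forall>p\<in>I. p y = 0)" by (rule ball_cong[OF refl])
  qed
  moreover have "algebraic_set n {x \<in> euclid n. \<forall>p\<in>I. p x = 0}"
    using assms unfolding algebraic_set_def by blast
  ultimately show ?thesis using algebraic by (simp add: def_pred_def)
qed

text \<open>The defined set is the projection of a definable set in one more dimension. The bound
  value is a separate argument of \<open>Q\<close>; the second assumption makes \<open>Q x\<close>
  blind to coordinate \<open>n\<close>, where that value is stored.\<close>

lemma def_pred_ex:
  assumes "def_pred (Suc n) (\<lambda>x. Q x (x n))" "\<And>x s t. Q (x(n := s)) t = Q x t"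
  shows "def_pred n (\<lambda>x. \<exists>t. Q x t)"
proof -
  have "depends n (\<lambda>x. \<exists>t. Q x t)"
    unfolding depends_def
  proof (intro allI impI)
    fix x y :: "nat \<Rightarrow> real" assume xy: "\<forall>i<n. x i = y i"
    have "Q x t = Q y t" for t
    proof -
      have "Q (x(n := t)) t = Q (y(n := t)) t"
      proof -
        have "(x(n := t)) i = (y(n := t)) i" if "i < Suc n" for i using that xy by simp
        from dependsD[OF def_pred_depends[OF assms(1)], of "x(n := t)" "y(n := t)", OF this]
        show ?thesis by simp
      qed
      then show ?thesis by (simp add: assms(2))
    qed
    then show "(\<exists>t. Q x t) = (\<exists>t. Q y t)" by simp
  qed
  moreover have "{x \<in> euclid n. \<exists>t. Q x t} = (\<lambda>x. restrict x {..<n}) ` {x \<in> euclid (Suc n). Q x (x n)}"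
  proof (intro equalityI subsetI)
    fix x assume "x \<in> {x \<in> euclid n. \<exists>t. Q x t}"
    then obtain t where x: "x \<in> euclid n" and t: "Q x t" by auto
    have "restrict (x(n := t)) {..<n} = x" using x by (auto simp: euclid_iff fun_eq_iff)
    moreover have "x(n := t) \<in> euclid (Suc n)" using x by (auto simp: euclid_iff)
    ultimately show "x \<in> (\<lambda>x. restrict x {..<n}) ` {x \<in> euclid (Suc n). Q x (x n)}"
      using t assms(2) by (intro image_eqI[of _ _ "x(n := t)"]) auto
  next
    fix x assume "x \<in> (\<lambda>x. restrict x {..<n}) ` {x \<in> euclid (Suc n). Q x (x n)}"
    then obtain z where z: "z \<in> euclid (Suc n)" "Q z (z n)" "x = restrict z {..<n}" by auto
    have "x(n := z n) = z" using z by (auto simp: euclid_iff fun_eq_iff)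
    then have "Q x (z n)" using z(2) assms(2)[of x "z n" "z n"] by simp
    then show "x \<in> {x \<in> euclid n. \<exists>t. Q x t}" using z(3) restrict_in_euclid by auto
  qed
  ultimately show ?thesis
    using assms(1) proj_closed by (simp add: def_pred_def)
qed

lemma def_pred_all:
  assumes "def_pred (Suc n) (\<lambda>x. Q x (x n))" "\<And>x s t. Q (x(n := s)) t = Q x t"
  shows "def_pred n (\<lambda>x. \<forall>t. Q x t)"
  using def_pred_not[OF def_pred_ex[where Q = "\<lambda>x t. \<not> Q x t", OF def_pred_not[OF assms(1)]]] assms(2) by simp

text \<open>Iterates \<open>def_pred_ex\<close>: the last \<open>k\<close> coordinates are
  quantified together, through an assignment \<open>z\<close> that keeps the first \<open>n\<close>
  values of \<open>x\<close>.\<close>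

lemma def_pred_exs: "def_pred (n + k) P \<Longrightarrow> def_pred n (\<lambda>x. \<exists>z. (\<forall>i<n. z i = x i) \<and> P z)"
proof (induction k arbitrary: P)
  case 0
  have "(\<lambda>x. \<exists>z. (\<forall>i<n. z i = x i) \<and> P z) = P"
    using def_pred_depends[OF 0[simplified]] unfolding depends_def by (intro ext) blast
  then show ?case using 0 by simp
next
  case (Suc k)
  have "def_pred (n + k) (\<lambda>x. \<exists>t. P (x(n + k := t)))"
    using Suc.prems by (intro def_pred_ex) simp_all
  from Suc.IH[OF this]
  have *: "def_pred n (\<lambda>x. \<exists>z. (\<forall>i<n. z i = x i) \<and> (\<exists>t. P (z(n + k := t))))" .
  have "(\<lambda>x. \<exists>z. (\<forall>i<n. z i = x i) \<and> (\<exists>t. P (z(n + k := t)))) =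
    (\<lambda>x. \<exists>z. (\<forall>i<n. z i = x i) \<and> P z)"
  proof (intro ext iffI)
    fix x :: "nat \<Rightarrow> real"
    assume "\<exists>z. (\<forall>i<n. z i = x i) \<and> (\<exists>t. P (z(n + k := t)))"
    then obtain z t where "\<forall>i<n. z i = x i" "P (z(n + k := t))" by auto
    then show "\<exists>z. (\<forall>i<n. z i = x i) \<and> P z"
      by (intro exI[of _ "z(n + k := t)"]) auto
  next
    fix x :: "nat \<Rightarrow> real"
    assume "\<exists>z. (\<forall>i<n. z i = x i) \<and> P z"
    then obtain z where "\<forall>i<n. z i = x i" "P z" by auto
    then show "\<exists>z. (\<forall>i<n. z i = x i) \<and> (\<exists>t. P (z(n + k := t)))"
      by (intro exI[of _ z] conjI exI[of _ "z (n + k)"]) simp_all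
  qed
  with * show ?case by simp
qed

lemma def_pred_shift1:
  assumes "def_pred k P" shows "def_pred (Suc k) (\<lambda>z. P (\<lambda>j. z (Suc j)))"
proof -
  have "{case_nat t x | t x. x \<in> {x \<in> euclid k. P x}} = {z \<in> euclid (Suc k). P (\<lambda>j. z (Suc j))}"
  proof (intro equalityI subsetI)
    fix z assume "z \<in> {z \<in> euclid (Suc k). P (\<lambda>j. z (Suc j))}"
    moreover have "z = case_nat (z 0) (\<lambda>j. z (Suc j))" by (auto simp: fun_eq_iff split: nat.splits)
    moreover have "(\<lambda>j. z (Suc j)) \<in> euclid k" if "z \<in> euclid (Suc k)" using that by (simp add: euclid_iff)
    ultimately show "z \<in> {case_nat t x | t x. x \<in> {x \<in> euclid k. P x}}" by blast
  qed (auto simp: euclid_iff split: nat.splits)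
  moreover have "depends (Suc k) (\<lambda>z. P (\<lambda>j. z (Suc j)))"
    unfolding depends_def
  proof (intro allI impI)
    fix x y :: "nat \<Rightarrow> real" assume "\<forall>i<Suc k. x i = y i"
    then show "P (\<lambda>j. x (Suc j)) = P (\<lambda>j. y (Suc j))"
      by (intro dependsD[OF def_pred_depends[OF assms]]) simp
  qed
  ultimately show ?thesis
    using assms line_times[of "{x \<in> euclid k. P x}" k] by (simp add: def_pred_def)
qed

lemma def_pred_shift: "def_pred k P \<Longrightarrow> def_pred (n + k) (\<lambda>z. P (\<lambda>j. z (n + j)))"
proof (induction n)
  case (Suc n)
  then show ?case using def_pred_shift1[of "n + k" "\<lambda>z. P (\<lambda>j. z (n + j))"] by simp
qed simp

text \<open>A copy of \<open>P\<close> is shifted to \<open>k\<close> fresh coordinates, these are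
  tied to \<open>x (\<sigma> j)\<close> by polynomial equations and then projected away. As
  \<open>\<sigma>\<close> may be any map into the first \<open>n\<close> indices, this covers
  permuting, identifying and adding variables.\<close>

lemma def_pred_rename:
  assumes P: "def_pred k P" and \<sigma>: "\<And>j. j < k \<Longrightarrow> \<sigma> j < n"
  shows "def_pred n (\<lambda>x. P (\<lambda>j. x (\<sigma> j)))"
proof -
  define I where "I = (\<lambda>j (z :: nat \<Rightarrow> real). z (n + j) - z (\<sigma> j)) ` {..<k}"
  have "def_pred (n + k) (\<lambda>z. \<forall>p\<in>I. p z = 0)"
  proof (rule def_pred_poly)
    show "finite I" by (simp add: I_def)
    fix p assume "p \<in> I"
    then obtain j where "j < k" "p = (\<lambda>z. z (n + j) - z (\<sigma> j))" by (auto simp: I_def)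
    then show "poly_fun (n + k) p"
      using \<sigma>[of j] by (auto intro!: poly_fun_intros)
  qed
  from def_pred_exs[OF def_pred_conj[OF def_pred_shift[OF P, of n] this]]
  have *: "def_pred n (\<lambda>x. \<exists>z. (\<forall>i<n. z i = x i) \<and> P (\<lambda>j. z (n + j)) \<and> (\<forall>p\<in>I. p z = 0))" .
  have "(\<exists>z. (\<forall>i<n. z i = x i) \<and> P (\<lambda>j. z (n + j)) \<and> (\<forall>p\<in>I. p z = 0)) = P (\<lambda>j. x (\<sigma> j))" for x
  proof
    assume "\<exists>z. (\<forall>i<n. z i = x i) \<and> P (\<lambda>j. z (n + j)) \<and> (\<forall>p\<in>I. p z = 0)"
    then obtain z where z: "\<And>i. i < n \<Longrightarrow> z i = x i" "P (\<lambda>j. z (n + j))" "\<forall>p\<in>I. p z = 0" by auto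
    then have "P (\<lambda>j. z (n + j)) = P (\<lambda>j. x (\<sigma> j))"
      using \<sigma> by (intro dependsD[OF def_pred_depends[OF P]]) (auto simp: I_def)
    with z show "P (\<lambda>j. x (\<sigma> j))" by simp
  next
    assume "P (\<lambda>j. x (\<sigma> j))"
    then show "\<exists>z. (\<forall>i<n. z i = x i) \<and> P (\<lambda>j. z (n + j)) \<and> (\<forall>p\<in>I. p z = 0)"
      using \<sigma> by (intro exI[of _ "\<lambda>i. if i < n then x i else x (\<sigma> (i - n))"]) (auto simp: I_def)
  qed
  with * show ?thesis by simp
qed

lemma def_pred_mono: "def_pred k P \<Longrightarrow> k \<le> n \<Longrightarrow> def_pred n P"
  using def_pred_rename[of k P "\<lambda>j. j" n] by simp

section \<open>Definable terms and substitution\<close>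

lemma def_term_depends: "def_term n F \<Longrightarrow> depends n F"
  by (simp add: def_term_def)

lemma def_term_graph: "def_term n F \<Longrightarrow> n \<le> m \<Longrightarrow> i < m \<Longrightarrow> def_pred m (\<lambda>x. x i = F x)"
proof -
  assume *: "def_term n F" "n \<le> m" "i < m"
  \<comment> \<open>The renaming sends the output coordinate \<open>n\<close> to \<open>i\<close>
    and fixes all others; the test \<open>n = n\<close> is its value at \<open>n\<close>.\<close>
  have "def_pred m (\<lambda>x. x (if n = n then i else n) = F (\<lambda>j. x (if j = n then i else j)))"
    using * def_pred_rename[of "Suc n" "\<lambda>x. x n = F x" "\<lambda>j. if j = n then i else j" m] by (auto simp: def_term_def)
  moreover have "F (\<lambda>j. x (if j = n then i else j)) = F x" for x
    by (rule dependsD[OF def_term_depends[OF *(1)]]) auto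
  ultimately show ?thesis by simp
qed

lemma def_term_mono: "def_term n F \<Longrightarrow> n \<le> m \<Longrightarrow> def_term m F"
  using def_term_graph[of n F "Suc m" m] depends_mono[OF def_term_depends] by (simp add: def_term_def[of m])

text \<open>Substitution is a quantifier over the value \<open>t = F x\<close>, which the graph of
  \<open>F\<close> singles out.\<close>

lemma def_pred_subst:
  assumes P: "def_pred (Suc n) P" and F: "def_term n F"
  shows "def_pred n (\<lambda>x. P (x(n := F x)))"
proof -
  have "def_pred n (\<lambda>x. \<exists>t. t = F x \<and> P (x(n := t)))"
  proof (rule def_pred_ex)
    show "def_pred (Suc n) (\<lambda>x. x n = F x \<and> P (x(n := x n)))"
      using def_pred_conj[OF def_term_graph[OF F, of "Suc n" n] P] by simp
    show "(t = F (x(n := s)) \<and> P (x(n := s, n := t))) = (t = F x \<and> P (x(n := t)))" for x s t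
      using depends_fun_upd[OF def_term_depends[OF F], of n x s] by simp
  qed
  then show ?thesis by simp
qed

text \<open>The relation is moved to three fresh coordinates behind the first \<open>n\<close>. The
  terms replace them one at a time, the last first, so that the substituted coordinate is always the
  top one.\<close>

lemma def_pred_rel3:
  assumes R: "def_pred 3 (\<lambda>x. R (x 0) (x 1) (x 2))" and F: "def_term n F" and G: "def_term n G" and H: "def_term n H"
  shows "def_pred n (\<lambda>x. R (F x) (G x) (H x))"
proof -
  have "def_pred (Suc (Suc (Suc n))) (\<lambda>x. R (x n) (x (Suc n)) (x (Suc (Suc n))))"
    using def_pred_rename[OF R, of "\<lambda>j. n + j" "Suc (Suc (Suc n))"] by simp
  from def_pred_subst[OF this def_term_mono[OF H]]
  have "def_pred (Suc (Suc n)) (\<lambda>x. R (x n) (x (Suc n)) (H x))" by simp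
  from def_pred_subst[OF this def_term_mono[OF G]]
  have "def_pred (Suc n) (\<lambda>x. R (x n) (G x) (H x))"
    using depends_fun_upd[OF def_term_depends[OF H]] by simp
  from def_pred_subst[OF this F] show ?thesis
    using depends_fun_upd[OF def_term_depends[OF H]] depends_fun_upd[OF def_term_depends[OF G]] by simp
qed

lemma def_pred_rel2:
  assumes R: "def_pred 2 (\<lambda>x. R (x 0) (x 1))" and F: "def_term n F" and G: "def_term n G"
  shows "def_pred n (\<lambda>x. R (F x) (G x))"
  using def_pred_rel3[of "\<lambda>x y z. R x y", OF def_pred_mono[OF R] F G G] by simp

lemma def_pred_rel1:
  assumes R: "def_pred 1 (\<lambda>x. R (x 0))" and F: "def_term n F"
  shows "def_pred n (\<lambda>x. R (F x))"
  using def_pred_rel3[of "\<lambda>x y z. R x", OF def_pred_mono[OF R] F F F] by simp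

text \<open>Reduces closure of terms under an operation to definability of its graph as a ternary
  relation.\<close>

lemma def_term_op2:
  assumes R: "def_pred 3 (\<lambda>x. x 0 = h (x 1) (x 2))" and F: "def_term n F" and G: "def_term n G"
  shows "def_term n (\<lambda>x. h (F x) (G x))"
proof -
  have v: "def_term (Suc n) (\<lambda>x. x n)"
  proof -
    have "def_pred (Suc (Suc n)) (\<lambda>x. \<forall>p\<in>{\<lambda>x. x (Suc n) - x n}. p x = 0)"
      by (intro def_pred_poly) (auto intro!: poly_fun_intros)
    then show ?thesis by (simp add: def_term_def depends_def)
  qed
  have "def_pred (Suc n) (\<lambda>x. x n = h (F x) (G x))"
    using def_pred_rel3[of "\<lambda>x y z. x = h y z", OF R v def_term_mono[OF F] def_term_mono[OF G]] by simp
  moreover have "depends n (\<lambda>x. h (F x) (G x))"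
    using def_term_depends[OF F] def_term_depends[OF G] unfolding depends_def
    by (intro allI impI arg_cong2[where f = h]) blast+
  ultimately show ?thesis by (simp add: def_term_def)
qed

lemma def_term_poly: "poly_fun n p \<Longrightarrow> def_term n p"
proof -
  assume p: "poly_fun n p"
  have *: "poly_fun m p" if "n \<le> m" for m
    using p that by (induction rule: poly_fun.induct) (auto intro: poly_fun_intros)
  have "def_pred (Suc n) (\<lambda>x. \<forall>p\<in>{\<lambda>x. x n - p x}. p x = 0)"
    by (intro def_pred_poly) (auto intro!: poly_fun_intros *)
  then show ?thesis using poly_fun_depends[OF p] by (simp add: def_term_def)
qed

lemma def_term_var: "i < n \<Longrightarrow> def_term n (\<lambda>x. x i)"
  by (intro def_term_poly poly_fun_intros)

lemma def_term_const: "def_term n (\<lambda>x. c)"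
  by (intro def_term_poly poly_fun_intros)

lemma def_term_add: "def_term n F \<Longrightarrow> def_term n G \<Longrightarrow> def_term n (\<lambda>x. F x + G x)"
proof (rule def_term_op2[where h = "(+)"])
  have "def_pred 3 (\<lambda>x. \<forall>p\<in>{\<lambda>x. x 0 - (x 1 + x 2)}. p x = 0)"
    by (intro def_pred_poly) (auto intro!: poly_fun_intros)
  then show "def_pred 3 (\<lambda>x. x 0 = x 1 + x 2)" by (simp add: algebra_simps)
qed

lemma def_term_mult: "def_term n F \<Longrightarrow> def_term n G \<Longrightarrow> def_term n (\<lambda>x. F x * G x)"
proof (rule def_term_op2[where h = "(*)"])
  have "def_pred 3 (\<lambda>x. \<forall>p\<in>{\<lambda>x. x 0 - (x 1 * x 2)}. p x = 0)"
    by (intro def_pred_poly) (auto intro!: poly_fun_intros)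
  then show "def_pred 3 (\<lambda>x. x 0 = x 1 * x 2)" by (simp add: algebra_simps)
qed

lemma def_term_minus: "def_term n F \<Longrightarrow> def_term n (\<lambda>x. - F x)"
  using def_term_mult[OF def_term_const[of n "-1"]] by simp

lemma def_term_diff: "def_term n F \<Longrightarrow> def_term n G \<Longrightarrow> def_term n (\<lambda>x. F x - G x)"
  using def_term_add[OF _ def_term_minus] by simp

lemma def_term_power: "def_term n F \<Longrightarrow> def_term n (\<lambda>x. F x ^ k)"
  by (induction k) (auto intro: def_term_const def_term_mult)

lemma def_pred_eq: "def_term n F \<Longrightarrow> def_term n G \<Longrightarrow> def_pred n (\<lambda>x. F x = G x)"
proof (rule def_pred_rel2)
  have "def_pred 2 (\<lambda>x. \<forall>p\<in>{\<lambda>x. x 0 - x 1}. p x = 0)"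
    by (intro def_pred_poly) (auto intro!: poly_fun_intros)
  then show "def_pred 2 (\<lambda>x. x 0 = x 1)" by simp
qed

text \<open>Positive reals are the nonzero squares, so the order is the projection of an algebraic
  relation: \<open>a < b\<close> holds exactly if \<open>(b - a) * (t * t) = 1\<close> has a
  solution.\<close>

lemma def_pred_less: "def_term n F \<Longrightarrow> def_term n G \<Longrightarrow> def_pred n (\<lambda>x. F x < G x)"
proof (rule def_pred_rel2)
  have "def_pred 2 (\<lambda>x. \<exists>t. (x 1 - x 0) * (t * t) = 1)"
    by (rule def_pred_ex) (auto intro!: def_pred_eq def_term_mult def_term_diff def_term_var def_term_const)
  moreover have "(\<exists>t. (b - a) * (t * t) = 1) \<longleftrightarrow> a < b" for a b :: real
  proof
    assume "\<exists>t. (b - a) * (t * t) = 1"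
    then obtain t where "(b - a) * (t * t) = 1" by auto
    then have "0 < (b - a) * (t * t)" by simp
    then show "a < b" using zero_less_mult_iff[of "b - a" "t * t"] not_square_less_zero[of t] by auto
  next
    assume "a < b"
    then show "\<exists>t. (b - a) * (t * t) = 1"
      by (intro exI[of _ "1 / sqrt (b - a)"]) (simp add: field_simps)
  qed
  ultimately show "def_pred 2 (\<lambda>x. x 0 < x 1)" by simp
qed

lemma def_pred_le: "def_term n F \<Longrightarrow> def_term n G \<Longrightarrow> def_pred n (\<lambda>x. F x \<le> G x)"
  using def_pred_not[OF def_pred_less] by (simp add: not_less)

lemma def_term_I: "def_pred (Suc n) (\<lambda>x. x n = F x) \<Longrightarrow> (\<And>x s. F (x(n := s)) = F x) \<Longrightarrow> def_term n F"
proof -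
  assume *: "def_pred (Suc n) (\<lambda>x. x n = F x)" and F: "\<And>x s. F (x(n := s)) = F x"
  have "F x = F y" if "\<forall>i<n. x i = y i" for x y
  proof -
    \<comment> \<open>With the value \<open>F y\<close> in coordinate \<open>n\<close> of both
      assignments, the graph predicate holds at the second one, hence also at the first.\<close>
    let ?t = "F y"
    have "((x(n := ?t)) n = F (x(n := ?t))) = ((y(n := ?t)) n = F (y(n := ?t)))"
      using that by (intro dependsD[OF def_pred_depends[OF *]]) (auto simp: less_Suc_eq)
    then show ?thesis by (simp add: F)
  qed
  then show ?thesis using * by (simp add: def_term_def depends_def)
qed

lemma def_term_If:
  assumes "def_pred n P" "def_term n F" "def_term n G"
  shows "def_term n (\<lambda>x. if P x then F x else G x)"
proof -
  have "def_pred (Suc n) (\<lambda>x. (P x \<and> x n = F x) \<or> (\<not> P x \<and> x n = G x))"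
    using assms by (intro def_pred_disj def_pred_conj def_pred_not def_pred_eq def_term_var) (auto intro: def_pred_mono def_term_mono)
  moreover have "(\<lambda>x :: nat \<Rightarrow> real. (P x \<and> x n = F x) \<or> (\<not> P x \<and> x n = G x)) =
     (\<lambda>x. x n = (if P x then F x else G x))" by auto
  moreover have "depends n (\<lambda>x. if P x then F x else G x)"
    using def_pred_depends[OF assms(1)] def_term_depends[OF assms(2)] def_term_depends[OF assms(3)]
    unfolding depends_def by (intro allI impI if_cong) blast+
  ultimately show ?thesis by (simp add: def_term_def)
qed

lemma def_term_abs: "def_term n F \<Longrightarrow> def_term n (\<lambda>x. \<bar>F x\<bar>)"
  unfolding abs_if by (intro def_term_If def_pred_less def_term_minus def_term_const)

definition def_fun :: "(real \<Rightarrow> real) \<Rightarrow> bool" where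
  "def_fun w \<longleftrightarrow> def_term 1 (\<lambda>x. w (x 0))"

lemma def_term_app: assumes "def_fun w" "def_term n F" shows "def_term n (\<lambda>x. w (F x))"
proof -
  have "def_pred 2 (\<lambda>x. x 0 = w (x 1))"
    using def_pred_rename[of 2 "\<lambda>x. x 1 = w (x 0)" "\<lambda>j. 1 - j" 2] assms(1)
    by (simp add: def_fun_def def_term_def numeral_2_eq_2)
  then have "def_pred 3 (\<lambda>x. x 0 = w (x 1))" by (rule def_pred_mono) simp
  from def_term_op2[of "\<lambda>u v. w u", OF this assms(2) assms(2)] show ?thesis .
qed

lemma def_funI: "def_pred 2 (\<lambda>x. x 1 = w (x 0)) \<Longrightarrow> def_fun w"
  unfolding def_fun_def by (rule def_term_I) (simp_all add: numeral_2_eq_2)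

lemmas def_pred_intros = def_pred_not def_pred_disj def_pred_conj def_pred_imp def_pred_eq def_pred_less
  def_pred_le def_term_add def_term_mult def_term_diff def_term_minus def_term_power def_term_abs def_term_If
  def_term_var def_term_const

text \<open>Connects the calculus of terms with definability as used in the theorem.\<close>

lemma def_fun_iff: "def_fun w \<longleftrightarrow> definable_real_fun S w"
proof -
  have "{x(1 := w (x 0)) | x. x \<in> euclid 1} = {x \<in> euclid 2. x 1 = w (x 0)}"
  proof (intro equalityI subsetI)
    fix x assume x: "x \<in> {x \<in> euclid 2. x 1 = w (x 0)}"
    then have "x = (restrict x {..<1})(1 := w ((restrict x {..<1}) 0))"
      by (auto simp: fun_eq_iff euclid_iff)
    then show "x \<in> {x(1 := w (x 0)) | x. x \<in> euclid 1}" using restrict_in_euclid by blast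
  qed (auto simp: euclid_iff)
  then show ?thesis
    by (auto simp: def_fun_def def_term_def def_pred_def definable_real_fun_def definable_fun_def depends_def numeral_2_eq_2)
qed

end

section \<open>Germs of definable functions of one variable\<close>

text \<open>Each strict local minimum has an interval with rational end points on which it is the
  only minimizer. Two of them cannot share an interval, so they inject into the pairs of
  rationals.\<close>

lemma countable_strict_local_minima:
  fixes w :: "real \<Rightarrow> real"
  shows "countable {t. (\<forall>\<^sub>F s in at_left t. w t < w s) \<and> (\<forall>\<^sub>F s in at_right t. w t < w s)}"
    (is "countable ?A")
proof -
  define P where "P t q \<longleftrightarrow> real_of_rat (fst q) < t \<and> t < real_of_rat (snd q) \<and>
      (\<forall>s. real_of_rat (fst q) < s \<longrightarrow> s < real_of_rat (snd q) \<longrightarrow> s \<noteq> t \<longrightarrow> w t < w s)"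
    for t and q :: "rat \<times> rat"
  have "\<exists>q. P t q" if t: "t \<in> ?A" for t
  proof -
    obtain a where a: "a < t" "\<And>s. a < s \<Longrightarrow> s < t \<Longrightarrow> w t < w s"
      using t by (auto simp: eventually_at_left_field)
    obtain b where b: "t < b" "\<And>s. t < s \<Longrightarrow> s < b \<Longrightarrow> w t < w s"
      using t by (auto simp: eventually_at_right_field)
    obtain q where q: "a < real_of_rat q" "real_of_rat q < t" using of_rat_dense[OF a(1)] by blast
    obtain r where r: "t < real_of_rat r" "real_of_rat r < b" using of_rat_dense[OF b(1)] by blast
    have "w t < w s" if "real_of_rat q < s" "s < real_of_rat r" "s \<noteq> t" for s
      using a(2)[of s] b(2)[of s] q r that by linarith
    with q r have "P t (q, r)" by (simp add: P_def)
    then show ?thesis ..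
  qed
  then have "\<forall>t\<in>?A. \<exists>q. P t q" by blast
  then obtain q where q: "\<forall>t\<in>?A. P t (q t)" by (rule bchoice[THEN exE])
  have "inj_on q ?A"
  proof (rule inj_onI, rule ccontr)
    fix s t assume "s \<in> ?A" "t \<in> ?A" "q s = q t" "s \<noteq> t"
    then have "P s (q s)" "P t (q s)" using q by force+
    with \<open>s \<noteq> t\<close> have "w s < w t" "w t < w s" unfolding P_def by blast+
    then show False by simp
  qed
  then show ?thesis by (rule countableI')
qed

text \<open>Bisection by \<open>Bolzano\<close>: short intervals around \<open>x\<close> satisfy
  \<open>w c \<le> w x \<le> w d\<close>, and the inequality between end points is transitive over
  adjacent intervals.\<close>

lemma local_mono_imp_mono:
  fixes w :: "real \<Rightarrow> real"
  assumes "\<And>t. a < t \<Longrightarrow> t < b \<Longrightarrow> \<forall>\<^sub>F s in at_left t. w s \<le> w t"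
    and "\<And>t. a < t \<Longrightarrow> t < b \<Longrightarrow> \<forall>\<^sub>F s in at_right t. w t \<le> w s"
  shows "mono_on {a<..<b} w"
proof (rule mono_onI)
  fix r s :: real assume rs: "r \<in> {a<..<b}" "s \<in> {a<..<b}" "r \<le> s"
  show "w r \<le> w s"
    using \<open>r \<le> s\<close>
  proof (induction rule: Bolzano)
    case (local x)
    then have x: "a < x" "x < b" using rs by auto
    obtain l u where lu: "l < x" "\<And>y. l < y \<Longrightarrow> y < x \<Longrightarrow> w y \<le> w x" "x < u" "\<And>y. x < y \<Longrightarrow> y < u \<Longrightarrow> w x \<le> w y"
      using assms(1)[OF x] assms(2)[OF x] by (auto simp: eventually_at_left_field eventually_at_right_field)
    show ?case
    proof (intro exI[of _ "min (x - l) (u - x)"] conjI allI impI)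
      fix c d assume cd: "c \<le> x \<and> x \<le> d \<and> d - c < min (x - l) (u - x)"
      have "w c \<le> w x" using lu(2)[of c] cd by (cases "c = x") auto
      moreover have "w x \<le> w d" using lu(4)[of d] cd by (cases "d = x") auto
      ultimately show "w c \<le> w d" by simp
    qed (use lu in auto)
  qed auto
qed

text \<open>If \<open>J\<close> meets every right neighbourhood of \<open>a\<close>, then by
  convexity it contains everything between \<open>a\<close> and any of its points to the
  right.\<close>

lemma eventually_interval_cases:
  fixes J :: "real set"
  assumes "is_interval J"
  shows "(\<forall>\<^sub>F s in at_right a. s \<in> J) \<or> (\<forall>\<^sub>F s in at_right a. s \<notin> J)"
proof (cases "\<exists>b>a. \<forall>s>a. s < b \<longrightarrow> s \<notin> J")
  case True
  then show ?thesis by (auto simp: eventually_at_right_field)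
next
  case False
  then obtain b where b: "a < b" "b \<in> J" using gt_ex[of a] by blast
  have "s \<in> J" if "a < s" "s < b" for s
  proof -
    obtain r where "a < r" "r < s" "r \<in> J" using False \<open>a < s\<close> by blast
    with b that show ?thesis using mem_is_interval_1_I[OF assms, of r b s] by simp
  qed
  with b show ?thesis by (auto simp: eventually_at_right_field)
qed

section \<open>Definability of inverses and of one-sided eventual statements\<close>

context real_field_structure
begin

lemma def_term_inverse:
  assumes "def_term n F" shows "def_term n (\<lambda>x. inverse (F x))"
proof -
  \<comment> \<open>The first disjunct is the convention \<open>inverse 0 = 0\<close>.\<close>
  have "def_pred 2 (\<lambda>x. (x 0 = 0 \<and> x 1 = 0) \<or> x 0 * x 1 = 1)"
    by (intro def_pred_intros) simp_all
  moreover have "(a = 0 \<and> b = 0) \<or> a * b = 1 \<longleftrightarrow> b = inverse a" for a b :: real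
    by (auto simp: inverse_eq_divide eq_divide_eq mult.commute)
  ultimately have "def_fun inverse" by (intro def_funI) simp
  then show ?thesis using def_term_app assms by blast
qed

lemma def_term_divide: "def_term n F \<Longrightarrow> def_term n G \<Longrightarrow> def_term n (\<lambda>x. F x / G x)"
  unfolding divide_inverse by (intro def_term_mult def_term_inverse)

text \<open>Moves the inner variable up to coordinate \<open>Suc n\<close>, which frees coordinate
  \<open>n\<close> for the end point that an eventual statement quantifies first.\<close>

lemma def_pred_swap:
  assumes "def_pred (Suc n) (\<lambda>x. R x (x n))" "\<And>x s t. R (x(n := s)) t = R x t"
  shows "def_pred (Suc (Suc n)) (\<lambda>x. R x (x (Suc n)))"
proof -
  have "def_pred (Suc (Suc n)) (\<lambda>x. R (\<lambda>j. x (if j = n then Suc n else j)) (x (if n = n then Suc n else n)))"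
    using def_pred_rename[OF assms(1), of "\<lambda>j. if j = n then Suc n else j" "Suc (Suc n)"] by simp
  moreover have "R (\<lambda>j. x (if j = n then Suc n else j)) t = R x t" for x t
    using assms(2)[of x "x (Suc n)" t] by (simp add: fun_upd_def if_distrib[of x])
  ultimately show ?thesis by simp
qed

lemma def_pred_upd_Suc:
  assumes "def_pred (Suc n) (\<lambda>x. R x (x n))" "\<And>x s t. R (x(n := s)) t = R x t"
  shows "R (x(Suc n := s)) t = R x t"
proof -
  have "R (x(Suc n := s, n := t)) ((x(Suc n := s, n := t)) n) = R (x(n := t)) ((x(n := t)) n)"
    by (rule dependsD[OF def_pred_depends[OF assms(1)]]) simp
  then show ?thesis by (simp add: assms(2))
qed

text \<open>The filter unfolds to an end point and a condition on all points before it, which is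
  first order in \<open>R\<close>.\<close>

lemma def_pred_eventually_right:
  assumes "def_pred (Suc n) (\<lambda>x. R x (x n))" "\<And>x s t. R (x(n := s)) t = R x t" "def_term n F"
  shows "def_pred n (\<lambda>x. \<forall>\<^sub>F s in at_right (F x). R x s)"
proof -
  have F: "F (x(n := s)) = F x" for x s using depends_fun_upd[OF def_term_depends[OF assms(3)]] by simp
  have F': "F (x(Suc n := s)) = F x" for x s using depends_fun_upd[OF def_term_depends[OF assms(3)]] by simp
  show ?thesis
    unfolding eventually_at_right_field
    by (intro def_pred_ex def_pred_all def_pred_conj def_pred_imp def_pred_less def_pred_swap[OF assms(1,2)] def_term_var)
      (auto simp: F F' def_pred_upd_Suc[OF assms(1,2)] assms(2) intro: def_term_mono[OF assms(3)])
qed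

lemma def_pred_eventually_left:
  assumes "def_pred (Suc n) (\<lambda>x. R x (x n))" "\<And>x s t. R (x(n := s)) t = R x t" "def_term n F"
  shows "def_pred n (\<lambda>x. \<forall>\<^sub>F s in at_left (F x). R x s)"
proof -
  have F: "F (x(n := s)) = F x" for x s using depends_fun_upd[OF def_term_depends[OF assms(3)]] by simp
  have F': "F (x(Suc n := s)) = F x" for x s using depends_fun_upd[OF def_term_depends[OF assms(3)]] by simp
  show ?thesis
    unfolding eventually_at_left_field
    by (intro def_pred_ex def_pred_all def_pred_conj def_pred_imp def_pred_less def_pred_swap[OF assms(1,2)] def_term_var)
      (auto simp: F F' def_pred_upd_Suc[OF assms(1,2)] assms(2) intro: def_term_mono[OF assms(3)])
qed

lemma def_fun_minus: "def_fun w \<Longrightarrow> def_fun (\<lambda>t. - w t)"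
  unfolding def_fun_def by (rule def_term_minus)

end

section \<open>Dichotomies and monotonicity of germs\<close>

context o_minimal_structure
begin

text \<open>Of finitely many intervals, either one contains a right neighbourhood of
  \<open>a\<close>, or all avoid a common one. O-minimality enters the argument only through this
  lemma.\<close>

lemma eventually_right_cases:
  assumes "def_pred 1 (\<lambda>x. P (x 0))"
  shows "(\<forall>\<^sub>F s in at_right a. P s) \<or> (\<forall>\<^sub>F s in at_right a. \<not> P s)"
proof -
  let ?A = "{x \<in> euclid 1. P (x 0)}"
  have "(\<lambda>x. x 0) ` ?A = {t. P t}"
  proof (intro equalityI subsetI)
    fix t assume "t \<in> {t. P t}"
    then show "t \<in> (\<lambda>x. x 0) ` ?A"
      by (intro image_eqI[of _ _ "\<lambda>i. if i = 0 then t else undefined"]) (auto simp: euclid_iff)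
  qed auto
  then obtain \<J> where J: "finite \<J>" "\<And>J. J \<in> \<J> \<Longrightarrow> is_interval J" "{t. P t} = \<Union>\<J>"
    using assms o_minimal[of ?A] by (auto simp: def_pred_def)
  have P: "P s \<longleftrightarrow> (\<exists>J\<in>\<J>. s \<in> J)" for s using J(3) by auto
  show ?thesis
  proof (cases "\<exists>J\<in>\<J>. \<forall>\<^sub>F s in at_right a. s \<in> J")
    case True
    then show ?thesis by (auto simp: P elim: eventually_mono)
  next
    case False
    then have "\<forall>\<^sub>F s in at_right a. \<forall>J\<in>\<J>. s \<notin> J"
      using eventually_interval_cases[OF J(2)] J(1) by (intro eventually_ball_finite) auto
    then show ?thesis by (simp add: P)
  qed
qed

lemma eventually_left_cases:
  assumes "def_pred 1 (\<lambda>x. P (x 0))"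
  shows "(\<forall>\<^sub>F s in at_left a. P s) \<or> (\<forall>\<^sub>F s in at_left a. \<not> P s)"
proof -
  have "def_pred 1 (\<lambda>x. P (- (x 0)))"
    by (intro def_pred_rel1[OF assms] def_pred_intros) simp
  from eventually_right_cases[of "\<lambda>s. P (- s)", OF this] show ?thesis
    by (simp add: at_left_minus eventually_filtermap)
qed

lemma eventually_right_trichotomy:
  assumes "def_fun v"
  shows "(\<forall>\<^sub>F s in at_right a. v s < c) \<or> (\<forall>\<^sub>F s in at_right a. v s = c) \<or> (\<forall>\<^sub>F s in at_right a. c < v s)"
proof -
  have "def_pred 1 (\<lambda>x. v (x 0) < c)" "def_pred 1 (\<lambda>x. c < v (x 0))"
    by (intro def_pred_intros def_term_app[OF assms]; simp)+
  from eventually_right_cases[of "\<lambda>t. v t < c", OF this(1), of a]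
    eventually_right_cases[of "\<lambda>t. c < v t", OF this(2), of a]
  consider "\<forall>\<^sub>F s in at_right a. v s < c" | "\<forall>\<^sub>F s in at_right a. c < v s"
    | "\<forall>\<^sub>F s in at_right a. \<not> v s < c" "\<forall>\<^sub>F s in at_right a. \<not> c < v s" by blast
  then show ?thesis
  proof cases
    case 3
    then have "\<forall>\<^sub>F s in at_right a. v s = c" by eventually_elim simp
    then show ?thesis by simp
  qed simp_all
qed

lemma eventually_left_trichotomy:
  assumes "def_fun v"
  shows "(\<forall>\<^sub>F s in at_left a. v s < c) \<or> (\<forall>\<^sub>F s in at_left a. v s = c) \<or> (\<forall>\<^sub>F s in at_left a. c < v s)"
proof -
  have "def_pred 1 (\<lambda>x. v (x 0) < c)" "def_pred 1 (\<lambda>x. c < v (x 0))"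
    by (intro def_pred_intros def_term_app[OF assms]; simp)+
  from eventually_left_cases[of "\<lambda>t. v t < c", OF this(1), of a]
    eventually_left_cases[of "\<lambda>t. c < v t", OF this(2), of a]
  consider "\<forall>\<^sub>F s in at_left a. v s < c" | "\<forall>\<^sub>F s in at_left a. c < v s"
    | "\<forall>\<^sub>F s in at_left a. \<not> v s < c" "\<forall>\<^sub>F s in at_left a. \<not> c < v s" by blast
  then show ?thesis
  proof cases
    case 3
    then have "\<forall>\<^sub>F s in at_left a. v s = c" by eventually_elim simp
    then show ?thesis by simp
  qed simp_all
qed

text \<open>If no case held throughout a right neighbourhood, each would fail throughout one, and
  all three would fail at a common point. This makes a pointwise trichotomy uniform near
  \<open>a\<close>.\<close>

lemma eventually_right_uniform_cases:
  assumes "def_pred 1 (\<lambda>x. A (x 0))" "def_pred 1 (\<lambda>x. B (x 0))" "def_pred 1 (\<lambda>x. C (x 0))"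
    and "\<And>t. A t \<or> B t \<or> C t"
  shows "(\<forall>\<^sub>F t in at_right a. A t) \<or> (\<forall>\<^sub>F t in at_right a. B t) \<or> (\<forall>\<^sub>F t in at_right a. C t)"
proof (rule ccontr)
  assume "\<not> ?thesis"
  with eventually_right_cases[of A, OF assms(1), of a] eventually_right_cases[of B, OF assms(2), of a]
    eventually_right_cases[of C, OF assms(3), of a]
  have "\<forall>\<^sub>F t in at_right a. \<not> A t" "\<forall>\<^sub>F t in at_right a. \<not> B t" "\<forall>\<^sub>F t in at_right a. \<not> C t" by auto
  then have "\<forall>\<^sub>F t in at_right a. False"
    by eventually_elim (use assms(4) in blast)
  then show False by simp
qed

text \<open>
  Near \<open>a\<close>, the sign of \<open>w s - w t\<close> for \<open>s\<close> just left of \<open>t\<close> does not depend on \<open>t\<close>.  It cannot be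
  positive, since the strict local minima of \<open>w\<close> are only countably many.
\<close>

lemma mono_germ_aux:
  assumes w: "def_fun w" and up: "\<forall>\<^sub>F t in at_right a. \<forall>\<^sub>F s in at_right t. w t < w s"
  shows "\<exists>b>a. mono_on {a<..<b} w"
proof -
  have "def_pred 1 (\<lambda>x. \<forall>\<^sub>F s in at_left (x 0). w s < w (x 0))"
    "def_pred 1 (\<lambda>x. \<forall>\<^sub>F s in at_left (x 0). w s = w (x 0))"
    "def_pred 1 (\<lambda>x. \<forall>\<^sub>F s in at_left (x 0). w (x 0) < w s)"
    by (intro def_pred_eventually_left def_pred_intros def_term_app[OF w]; simp)+
  from eventually_right_uniform_cases[of "\<lambda>t. \<forall>\<^sub>F s in at_left t. w s < w t"
      "\<lambda>t. \<forall>\<^sub>F s in at_left t. w s = w t" "\<lambda>t. \<forall>\<^sub>F s in at_left t. w t < w s", OF this, of a]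
  consider (lt) "\<forall>\<^sub>F t in at_right a. \<forall>\<^sub>F s in at_left t. w s < w t"
    | (eq) "\<forall>\<^sub>F t in at_right a. \<forall>\<^sub>F s in at_left t. w s = w t"
    | (gt) "\<forall>\<^sub>F t in at_right a. \<forall>\<^sub>F s in at_left t. w t < w s"
    using eventually_left_trichotomy[OF w] by blast
  then show ?thesis
  proof cases
    case lt
    then obtain b where "b > a" and b: "\<And>t. a < t \<Longrightarrow> t < b \<Longrightarrow>
        (\<forall>\<^sub>F s in at_right t. w t < w s) \<and> (\<forall>\<^sub>F s in at_left t. w s < w t)"
      using eventually_conj[OF up lt] unfolding eventually_at_right_field[of _ a] by blast
    have "mono_on {a<..<b} w"
    proof (rule local_mono_imp_mono)
      fix t assume t: "a < t" "t < b"
      show "\<forall>\<^sub>F s in at_left t. w s \<le> w t"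
        by (rule eventually_mono[OF conjunct2[OF b[OF t]]]) simp
      show "\<forall>\<^sub>F s in at_right t. w t \<le> w s"
        by (rule eventually_mono[OF conjunct1[OF b[OF t]]]) simp
    qed
    with \<open>b > a\<close> show ?thesis by blast
  next
    case eq
    then obtain b where b: "b > a" "\<And>t. a < t \<Longrightarrow> t < b \<Longrightarrow> (\<forall>\<^sub>F s in at_right t. w t < w s) \<and> (\<forall>\<^sub>F s in at_left t. w s = w t)"
      using eventually_conj[OF up eq] unfolding eventually_at_right_field[of _ a] by blast
    define t where "t = (a + b) / 2"
    have t: "a < t" "t < b" using b(1) by (auto simp: t_def)
    obtain l where l: "l < t" "\<And>s. l < s \<Longrightarrow> s < t \<Longrightarrow> w s = w t"
      using b(2)[OF t] by (auto simp: eventually_at_left_field)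
    \<comment> \<open>At \<open>r\<close> the function already has the constant value it keeps up to
      \<open>t\<close>, yet it must exceed \<open>w r\<close> just to the right of \<open>r\<close>:
      a contradiction.\<close>
    define r where "r = (max a l + t) / 2"
    have r: "a < r" "l < r" "r < t" using l(1) t by (auto simp: r_def)
    then obtain u where u: "r < u" "\<And>s. r < s \<Longrightarrow> s < u \<Longrightarrow> w r < w s"
      using b(2)[of r] t by (auto simp: eventually_at_right_field)
    obtain s where "r < s" "s < min u t" using dense[of r "min u t"] u(1) r by auto
    with u(2)[of s] l(2)[of s] l(2)[of r] r show ?thesis by simp
  next
    case gt
    then obtain b where b: "b > a" "\<And>t. a < t \<Longrightarrow> t < b \<Longrightarrow> (\<forall>\<^sub>F s in at_right t. w t < w s) \<and> (\<forall>\<^sub>F s in at_left t. w t < w s)"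
      using eventually_conj[OF up gt] unfolding eventually_at_right_field[of _ a] by blast
    then have "countable {a<..<b}"
      by (intro countable_subset[OF _ countable_strict_local_minima[of w]]) auto
    with b(1) show ?thesis using uncountable_open_interval by blast
  qed
qed

lemma mono_germ:
  assumes w: "def_fun w"
  shows "\<exists>b>a. mono_on {a<..<b} w \<or> mono_on {a<..<b} (\<lambda>t. - w t)"
proof -
  have "def_pred 1 (\<lambda>x. \<forall>\<^sub>F s in at_right (x 0). w s < w (x 0))"
    "def_pred 1 (\<lambda>x. \<forall>\<^sub>F s in at_right (x 0). w s = w (x 0))"
    "def_pred 1 (\<lambda>x. \<forall>\<^sub>F s in at_right (x 0). w (x 0) < w s)"
    by (intro def_pred_eventually_right def_pred_intros def_term_app[OF w]; simp)+
  from eventually_right_uniform_cases[of "\<lambda>t. \<forall>\<^sub>F s in at_right t. w s < w t"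
      "\<lambda>t. \<forall>\<^sub>F s in at_right t. w s = w t" "\<lambda>t. \<forall>\<^sub>F s in at_right t. w t < w s", OF this, of a]
  consider (lt) "\<forall>\<^sub>F t in at_right a. \<forall>\<^sub>F s in at_right t. w s < w t"
    | (eq) "\<forall>\<^sub>F t in at_right a. \<forall>\<^sub>F s in at_right t. w s = w t"
    | (gt) "\<forall>\<^sub>F t in at_right a. \<forall>\<^sub>F s in at_right t. w t < w s"
    using eventually_right_trichotomy[OF w] by blast
  then show ?thesis
  proof cases
    case lt
    then show ?thesis using mono_germ_aux[OF def_fun_minus[OF w]] by auto
  next
    case gt
    then show ?thesis using mono_germ_aux[OF w] by auto
  next
    case eq
    \<comment> \<open>Constancy just to the right of every point does not exclude jumps from the
      left, so the left side is decided separately.\<close>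
    have "def_pred 1 (\<lambda>x. \<forall>\<^sub>F s in at_left (x 0). w s = w (x 0))"
      by (intro def_pred_eventually_left def_pred_intros def_term_app[OF w]; simp)
    from eventually_right_cases[of "\<lambda>t. \<forall>\<^sub>F s in at_left t. w s = w t", OF this, of a]
    show ?thesis
    proof
      assume "\<forall>\<^sub>F t in at_right a. \<forall>\<^sub>F s in at_left t. w s = w t"
      from eventually_conj[OF eq this] obtain b where "b > a" and b: "\<And>t. a < t \<Longrightarrow> t < b \<Longrightarrow>
          (\<forall>\<^sub>F s in at_right t. w s = w t) \<and> (\<forall>\<^sub>F s in at_left t. w s = w t)"
        unfolding eventually_at_right_field[of _ a] by blast
      have "mono_on {a<..<b} w"
      proof (rule local_mono_imp_mono)
        fix t assume t: "a < t" "t < b"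
        show "\<forall>\<^sub>F s in at_left t. w s \<le> w t"
          by (rule eventually_mono[OF conjunct2[OF b[OF t]]]) simp
        show "\<forall>\<^sub>F s in at_right t. w t \<le> w s"
          by (rule eventually_mono[OF conjunct1[OF b[OF t]]]) simp
      qed
      with \<open>b > a\<close> show ?thesis by blast
    next
      assume "\<forall>\<^sub>F t in at_right a. \<not> (\<forall>\<^sub>F s in at_left t. w s = w t)"
      from eventually_conj[OF eq this] obtain b where "b > a" and b: "\<And>t. a < t \<Longrightarrow> t < b \<Longrightarrow>
          (\<forall>\<^sub>F s in at_right t. w s = w t) \<and> \<not> (\<forall>\<^sub>F s in at_left t. w s = w t)"
        unfolding eventually_at_right_field[of _ a] by blast
      \<comment> \<open>Constancy to the right of \<open>t\<close> makes \<open>w\<close> constant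
        on an interval, and a point \<open>s\<close> inside it then has constancy on its left,
        against the assumption.\<close>
      obtain t where t: "a < t" "t < b" using dense[OF \<open>b > a\<close>] by blast
      then obtain u where u: "t < u" "\<And>s. t < s \<Longrightarrow> s < u \<Longrightarrow> w s = w t"
        using b[of t] by (auto simp: eventually_at_right_field)
      obtain s where s: "t < s" "s < min b u" using dense[of t "min b u"] t u(1) by auto
      then have "\<forall>r>t. r < s \<longrightarrow> w r = w s" using u(2) by simp
      then have "\<forall>\<^sub>F r in at_left s. w r = w s"
        unfolding eventually_at_left_field using s(1) by blast
      with b[of s] s t show ?thesis by simp
    qed
  qed
qed

end

text \<open>Subtracting the chord makes the end values equal; from a maximum point of the
  difference, every slope to the right is at most that of the chord.\<close>

lemma exists_upper_slope:
  fixes w :: "real \<Rightarrow> real"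
  assumes "a < b" "continuous_on {a..b} w"
  shows "\<exists>t\<in>{a..<b}. \<forall>s. t < s \<and> s \<le> b \<longrightarrow> (w s - w t) / (s - t) \<le> (w b - w a) / (b - a)"
proof -
  define c where "c = (w b - w a) / (b - a)"
  define v where "v s = w s - c * s" for s
  have "continuous_on {a..b} v"
    unfolding v_def by (intro continuous_intros assms)
  then obtain t0 where t0: "t0 \<in> {a..b}" "\<And>s. s \<in> {a..b} \<Longrightarrow> v s \<le> v t0"
    using continuous_attains_sup[of "{a..b}" v] assms(1) by auto
  have "c * (b - a) = w b - w a"
    using assms(1) by (simp add: c_def)
  then have "v a = v b"
    by (simp add: v_def algebra_simps)
  \<comment> \<open>If the maximum is found at \<open>b\<close>, then \<open>a\<close> attains it
    too, so there is a maximizer with room to its right.\<close>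
  then obtain t where t: "t \<in> {a..<b}" "\<And>s. s \<in> {a..b} \<Longrightarrow> v s \<le> v t"
    using t0 assms(1) by (cases "t0 = b") (auto intro: that[of a] that[of t0])
  have "(w s - w t) / (s - t) \<le> c" if "t < s" "s \<le> b" for s
  proof -
    have "v s \<le> v t" using t that by auto
    then have "w s - w t \<le> c * (s - t)" by (simp add: v_def algebra_simps)
    then show ?thesis using that by (simp add: divide_le_eq)
  qed
  with t(1) show ?thesis unfolding c_def by blast
qed

lemma tendsto_right_exists:
  fixes v :: "real \<Rightarrow> real"
  assumes "mono_on {a<..<b} v" "a < b" "\<forall>\<^sub>F s in at_right a. C \<le> v s"
  shows "\<exists>L. (v \<longlongrightarrow> L) (at_right a)"
proof -
  obtain d where d: "a < d" "\<And>s. a < s \<Longrightarrow> s < d \<Longrightarrow> C \<le> v s"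
    using assms(3) unfolding eventually_at_right_field by blast
  define e where "e = min b d"
  have e: "a < e" "e \<le> b" "e \<le> d" using d(1) assms(2) by (auto simp: e_def)
  have "(v \<longlongrightarrow> Inf (v ` ({a<..} \<inter> {..<e}))) (at a within ({a<..} \<inter> {..<e}))"
    by (rule Lim_right_bound[where K = C]) (use d e assms(1) in \<open>auto simp: mono_on_def\<close>)
  moreover have "at a within ({a<..} \<inter> {..<e}) = at_right a"
    by (rule at_within_nhd[of _ "{..<e}"]) (use e(1) in auto)
  ultimately show ?thesis by auto
qed

section \<open>Limits, continuity and differentiability of germs\<close>

context o_minimal_structure
begin

lemma def_pred_right_derivative:
  assumes w: "def_fun w" and "def_term n F" "def_term n G"
  shows "def_pred n (\<lambda>x. ((\<lambda>s. (w s - w (F x)) / (s - F x)) \<longlongrightarrow> G x) (at_right (F x)))"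
proof -
  have "def_pred 2 (\<lambda>x. ((\<lambda>s. (w s - w (x 0)) / (s - x 0)) \<longlongrightarrow> x 1) (at_right (x 0)))"
    unfolding tendsto_iff dist_real_def
    by (intro def_pred_all def_pred_imp def_pred_less def_pred_eventually_right def_term_abs def_term_diff def_term_divide def_term_app[OF w] def_term_var def_term_const) simp_all
  from def_pred_rel2[of "\<lambda>t L. ((\<lambda>s. (w s - w t) / (s - t)) \<longlongrightarrow> L) (at_right t)", OF this assms(2,3)]
  show ?thesis .
qed

lemma def_pred_isCont:
  assumes w: "def_fun w"
  shows "def_pred 1 (\<lambda>x. isCont w (x 0))"
  unfolding isCont_def filterlim_at_split tendsto_iff dist_real_def
  by (intro def_pred_all def_pred_imp def_pred_conj def_pred_less def_pred_eventually_right def_pred_eventually_left def_term_abs def_term_diff def_term_app[OF w] def_term_var def_term_const) simp_all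

text \<open>The germ is monotone by \<open>mono_germ\<close>, and a bounded monotone function has
  one-sided limits.\<close>

lemma bounded_germ_tendsto:
  assumes v: "def_fun v" and "\<forall>\<^sub>F s in at_right a. \<bar>v s\<bar> \<le> C"
  shows "\<exists>L. (v \<longlongrightarrow> L) (at_right a)"
proof -
  have 1: "\<forall>\<^sub>F s in at_right a. -C \<le> v s" "\<forall>\<^sub>F s in at_right a. -C \<le> - v s"
    using assms(2) by (auto elim!: eventually_mono)
  obtain b where b: "a < b" "mono_on {a<..<b} v \<or> mono_on {a<..<b} (\<lambda>t. - v t)"
    using mono_germ[OF v] by blast
  then consider L where "(v \<longlongrightarrow> L) (at_right a)" | L where "((\<lambda>t. - v t) \<longlongrightarrow> L) (at_right a)"
    using tendsto_right_exists[OF _ b(1) 1(1)] tendsto_right_exists[OF _ b(1) 1(2)] by blast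
  then show ?thesis
  proof cases
    case 2
    from tendsto_minus[OF this] show ?thesis by auto
  qed blast
qed

text \<open>By definability \<open>w\<close> is either continuous or discontinuous at all points
  near \<open>a\<close>; the latter is impossible, since a monotone function has only countably many
  discontinuities.\<close>

lemma continuous_germ_aux:
  assumes w: "def_fun w" and "mono_on {a<..<b} w" "a < b"
  shows "\<forall>\<^sub>F t in at_right a. isCont w t"
proof (rule ccontr)
  assume "\<not> ?thesis"
  then have "\<forall>\<^sub>F t in at_right a. \<not> isCont w t"
    using eventually_right_cases[of "isCont w", OF def_pred_isCont[OF w], of a] by blast
  then obtain d where d: "a < d" "\<And>t. a < t \<Longrightarrow> t < d \<Longrightarrow> \<not> isCont w t"
    unfolding eventually_at_right_field by blast
  have "{a<..<min b d} \<subseteq> {t \<in> {a<..<b}. \<not> isCont w t}" using d by auto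
  then have "countable {a<..<min b d}"
    using mono_on_ctble_discont_open[OF open_greaterThanLessThan assms(2)] by (rule countable_subset)
  then show False using d(1) assms(3) uncountable_open_interval[of a "min b d"] by simp
qed

lemma continuous_germ:
  assumes w: "def_fun w"
  shows "\<forall>\<^sub>F t in at_right a. isCont w t"
proof -
  obtain b where b: "a < b" "mono_on {a<..<b} w \<or> mono_on {a<..<b} (\<lambda>t. - w t)"
    using mono_germ[OF w] by blast
  from b(2) show ?thesis
  proof
    assume "mono_on {a<..<b} w"
    then show ?thesis by (rule continuous_germ_aux[OF w _ b(1)])
  next
    assume "mono_on {a<..<b} (\<lambda>t. - w t)"
    from continuous_germ_aux[OF def_fun_minus[OF w] this b(1)]
    show ?thesis by (rule eventually_mono) (auto dest: isCont_minus)
  qed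
qed

text \<open>
  One-sided difference quotients are definable, hence monotone near the base point, so they converge
  as soon as they are bounded.  A continuous function with a continuous right derivative is \<open>C\<^sup>1\<close>.
\<close>

lemma derivative_germ_aux:
  assumes w: "def_fun w" and mono: "mono_on {a<..<b} w" and "a < b"
  shows "\<exists>w'. def_fun w' \<and> (\<forall>\<^sub>F t in at_right a. (w has_real_derivative w' t) (at t))"
proof -
  define R where "R t L \<longleftrightarrow> ((\<lambda>s. (w s - w t) / (s - t)) \<longlongrightarrow> L) (at_right t)" for t L
  \<comment> \<open>The default \<open>0\<close> where no right derivative exists makes
    \<open>w'\<close> total; the second disjunct in the formula for its graph records it.\<close>
  define w' where "w' t = (if \<exists>L. R t L then THE L. R t L else 0)" for t
  have unique: "R t L \<Longrightarrow> R t L' \<Longrightarrow> L = L'" for t L L'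
    unfolding R_def by (rule tendsto_unique) auto
  have w'_R: "R t (w' t)" if "R t L" for t L
  proof -
    have "(THE L. R t L) = L" using that unique by blast
    then show ?thesis using that by (auto simp: w'_def)
  qed
  have "def_pred 2 (\<lambda>x. R (x 0) (x 1) \<or> (\<not> (\<exists>L. R (x 0) L) \<and> x 1 = 0))"
    unfolding R_def by (intro def_pred_disj def_pred_conj def_pred_not def_pred_ex def_pred_right_derivative[OF w] def_pred_eq def_term_var def_term_const) simp_all
  moreover have "R t L \<or> (\<not> (\<exists>L. R t L) \<and> L = 0) \<longleftrightarrow> L = w' t" for t L
  proof (cases "\<exists>L. R t L")
    case True
    then show ?thesis using w'_R unique by metis
  next
    case False
    then show ?thesis by (auto simp: w'_def)
  qed
  ultimately have w': "def_fun w'" by (intro def_funI) simp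
  have cont: "\<forall>\<^sub>F t in at_right a. isCont w t \<and> isCont w' t"
    using continuous_germ[OF w] continuous_germ[OF w'] by (rule eventually_conj)
  then obtain b1 where b1: "a < b1" "\<And>t. a < t \<Longrightarrow> t < b1 \<Longrightarrow> isCont w t"
    unfolding eventually_at_right_field by blast
  \<comment> \<open>At the point from \<open>exists_upper_slope\<close> the right quotients lie
    between \<open>0\<close>, by monotonicity, and the chord slope; being bounded, they converge.
    Such points occur in every short interval, so the right derivative cannot fail to exist
    throughout a right neighbourhood of \<open>a\<close>.\<close>
  have dense_R: "\<exists>t\<in>{c..<d}. \<exists>L. R t L" if cd: "a < c" "c < d" "d < min b b1" for c d
  proof -
    have "continuous_on {c..d} w"
      using b1 cd by (intro continuous_at_imp_continuous_on) auto
    from exists_upper_slope[OF cd(2) this] obtain t where t: "t \<in> {c..<d}"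
      "\<And>s. t < s \<Longrightarrow> s \<le> d \<Longrightarrow> (w s - w t) / (s - t) \<le> (w d - w c) / (d - c)" by blast
    have "0 \<le> (w s - w t) / (s - t)" if "t < s" "s \<le> d" for s
      using mono_onD[OF mono, of t s] that t(1) cd by auto
    then have "\<bar>(w s - w t) / (s - t)\<bar> \<le> (w d - w c) / (d - c)" if "t < s" "s < d" for s
      using t(2)[of s] that by (simp only: abs_of_nonneg less_imp_le)
    then have "\<forall>\<^sub>F s in at_right t. \<bar>(w s - w t) / (s - t)\<bar> \<le> (w d - w c) / (d - c)"
      unfolding eventually_at_right_field using t(1) by (intro exI[of _ d]) (simp del: abs_divide)
    moreover have "def_fun (\<lambda>s. (w s - w t) / (s - t))"
      unfolding def_fun_def by (intro def_term_diff def_term_divide def_term_app[OF w] def_term_var def_term_const) simp_all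
    ultimately have "\<exists>L. R t L"
      unfolding R_def using bounded_germ_tendsto by blast
    with t(1) show ?thesis by blast
  qed
  have "def_pred 1 (\<lambda>x. \<exists>L. R (x 0) L)"
    unfolding R_def by (intro def_pred_ex def_pred_right_derivative[OF w] def_term_var) simp_all
  from eventually_right_cases[of "\<lambda>t. \<exists>L. R t L", OF this, of a]
  have "\<forall>\<^sub>F t in at_right a. \<exists>L. R t L"
  proof
    assume "\<forall>\<^sub>F t in at_right a. \<not> (\<exists>L. R t L)"
    then obtain d where d: "a < d" "\<And>t. a < t \<Longrightarrow> t < d \<Longrightarrow> \<not> (\<exists>L. R t L)"
      unfolding eventually_at_right_field by blast
    obtain u where u: "a < u" "u < min d (min b b1)"
      using dense[of a "min d (min b b1)"] d(1) b1(1) \<open>a < b\<close> by auto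
    obtain c where c: "a < c" "c < u" using dense[OF u(1)] by blast
    then show ?thesis using dense_R[of c u] d(2) u by auto
  qed
  with cont have "\<forall>\<^sub>F t in at_right a. isCont w t \<and> isCont w' t \<and> (\<exists>L. R t L)"
    by eventually_elim simp
  then obtain e where e: "a < e" "\<And>t. a < t \<Longrightarrow> t < e \<Longrightarrow> isCont w t"
      "\<And>t. a < t \<Longrightarrow> t < e \<Longrightarrow> isCont w' t" "\<And>t. a < t \<Longrightarrow> t < e \<Longrightarrow> R t (w' t)"
    unfolding eventually_at_right_field using w'_R by blast
  \<comment> \<open>A mean value estimate for right derivatives: \<open>exists_upper_slope\<close>
    for \<open>w\<close> and for its negative encloses each chord slope between two values of
    \<open>w'\<close>.\<close>
  have slope: "\<exists>t\<in>{c..<d}. \<exists>u\<in>{c..<d}. w' t \<le> (w d - w c) / (d - c) \<and> (w d - w c) / (d - c) \<le> w' u"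
    if cd: "a < c" "c < d" "d < e" for c d
  proof -
    have "continuous_on {c..d} w"
      using e(2) cd by (intro continuous_at_imp_continuous_on) auto
    from exists_upper_slope[OF cd(2) this] obtain t where t: "t \<in> {c..<d}"
      "\<And>s. t < s \<Longrightarrow> s \<le> d \<Longrightarrow> (w s - w t) / (s - t) \<le> (w d - w c) / (d - c)" by blast
    have "continuous_on {c..d} (\<lambda>s. - w s)"
      using \<open>continuous_on {c..d} w\<close> by (intro continuous_intros)
    from exists_upper_slope[OF cd(2) this] obtain u where u: "u \<in> {c..<d}"
      "\<And>s. u < s \<Longrightarrow> s \<le> d \<Longrightarrow> (- w s - - w u) / (s - u) \<le> (- w d - - w c) / (d - c)" by blast
    have "w' t \<le> (w d - w c) / (d - c)"
    proof (rule tendsto_upperbound)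
      show "((\<lambda>s. (w s - w t) / (s - t)) \<longlongrightarrow> w' t) (at_right t)"
        using e(4)[of t] t(1) cd by (auto simp: R_def)
      show "\<forall>\<^sub>F s in at_right t. (w s - w t) / (s - t) \<le> (w d - w c) / (d - c)"
        unfolding eventually_at_right_field using t by (intro exI[of _ d]) auto
    qed simp
    moreover have "(w d - w c) / (d - c) \<le> w' u"
    proof (rule tendsto_lowerbound)
      show "((\<lambda>s. (w s - w u) / (s - u)) \<longlongrightarrow> w' u) (at_right u)"
        using e(4)[of u] u(1) cd by (auto simp: R_def)
      have "(w d - w c) / (d - c) \<le> (w s - w u) / (s - u)" if "u < s" "s \<le> d" for s
        using u(2)[OF that] minus_divide_left[of "w s - w u" "s - u"] minus_divide_left[of "w d - w c" "d - c"]
        by simp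
      then show "\<forall>\<^sub>F s in at_right u. (w d - w c) / (d - c) \<le> (w s - w u) / (s - u)"
        unfolding eventually_at_right_field using u(1) by (intro exI[of _ d]) auto
    qed simp
    ultimately show ?thesis using t(1) u(1) by blast
  qed
  have "(w has_real_derivative w' t) (at t)" if t: "a < t" "t < e" for t
    unfolding has_field_derivative_iff LIM_eq
  proof (intro allI impI)
    fix \<eta> :: real assume "0 < \<eta>"
    then obtain d where d: "d > 0" "\<And>s. s \<noteq> t \<Longrightarrow> \<bar>s - t\<bar> < d \<Longrightarrow> \<bar>w' s - w' t\<bar> < \<eta>"
      using e(3)[OF t] unfolding isCont_def LIM_eq by auto
    \<comment> \<open>This radius keeps \<open>u\<close> and \<open>v\<close> between
      \<open>a\<close> and \<open>e\<close>, and the points between them within the continuity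
      radius \<open>d\<close> of \<open>t\<close>.\<close>
    define r where "r = min d (min (t - a) (e - t))"
    have *: "\<bar>(w v - w u) / (v - u) - w' t\<bar> < \<eta>"
      if uv: "u < v" "u \<le> t" "t \<le> v" "v - u < r" for u v
    proof -
      obtain p q where pq: "p \<in> {u..<v}" "q \<in> {u..<v}"
        "w' p \<le> (w v - w u) / (v - u)" "(w v - w u) / (v - u) \<le> w' q"
        using slope[of u v] uv by (auto simp: r_def)
      have "\<bar>w' s - w' t\<bar> < \<eta>" if "s \<in> {u..<v}" for s
        using d(2)[of s] that uv \<open>0 < \<eta>\<close> by (cases "s = t") (auto simp: r_def)
      from this[OF pq(1)] this[OF pq(2)] pq(3,4) show ?thesis by linarith
    qed
    show "\<exists>r>0. \<forall>s. s \<noteq> t \<and> norm (s - t) < r \<longrightarrow> norm ((w s - w t) / (s - t) - w' t) < \<eta>"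
    proof (intro exI[of _ r] conjI allI impI)
      show "0 < r" using d(1) t by (simp add: r_def)
      fix s assume s: "s \<noteq> t \<and> norm (s - t) < r"
      show "norm ((w s - w t) / (s - t) - w' t) < \<eta>"
      proof (cases "t < s")
        case True
        then show ?thesis using *[of t s] s by simp
      next
        case False
        have "(w s - w t) / (s - t) = (w t - w s) / (t - s)"
          using minus_divide_divide[of "w s - w t" "s - t"] by simp
        then show ?thesis using *[of s t] s False by simp
      qed
    qed
  qed
  with w' e(1) show ?thesis
    unfolding eventually_at_right_field by blast
qed

lemma derivative_germ:
  assumes w: "def_fun w"
  shows "\<exists>w'. def_fun w' \<and> (\<forall>\<^sub>F t in at_right a. (w has_real_derivative w' t) (at t))"
proof -
  obtain b where b: "a < b" "mono_on {a<..<b} w \<or> mono_on {a<..<b} (\<lambda>t. - w t)"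
    using mono_germ[OF w] by blast
  from b(2) show ?thesis
  proof
    assume "mono_on {a<..<b} w"
    then show ?thesis by (rule derivative_germ_aux[OF w _ b(1)])
  next
    assume "mono_on {a<..<b} (\<lambda>t. - w t)"
    from derivative_germ_aux[OF def_fun_minus[OF w] this b(1)]
    obtain v where v: "def_fun v" "\<forall>\<^sub>F t in at_right a. ((\<lambda>t. - w t) has_real_derivative v t) (at t)" by blast
    from v(2) have "\<forall>\<^sub>F t in at_right a. (w has_real_derivative - v t) (at t)"
      by (rule eventually_mono) (auto dest: DERIV_minus)
    with def_fun_minus[OF v(1)] show ?thesis by blast
  qed
qed

lemma euler_derivative_tendsto_0:
  assumes "def_fun w" and w0: "(w \<longlongrightarrow> 0) (at_right 0)"
    and w': "def_fun w'" and der: "\<forall>\<^sub>F t in at_right 0. (w has_real_derivative w' t) (at t)"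
  shows "((\<lambda>t. t * w' t) \<longlongrightarrow> 0) (at_right 0)"
proof -
  have "def_fun (\<lambda>t. \<bar>w' t\<bar>)"
    unfolding def_fun_def by (intro def_term_abs def_term_app[OF w'] def_term_var) simp
  from mono_germ[OF this, of 0] obtain b where b: "0 < b"
    "mono_on {0<..<b} (\<lambda>t. \<bar>w' t\<bar>) \<or> mono_on {0<..<b} (\<lambda>t. - \<bar>w' t\<bar>)" by blast
  obtain d where d: "0 < d" "\<And>t. 0 < t \<Longrightarrow> t < d \<Longrightarrow> (w has_real_derivative w' t) (at t)"
    using der unfolding eventually_at_right_field by blast
  from b(2) show ?thesis
  proof
    \<comment> \<open>A nondecreasing modulus is bounded near \<open>0\<close> by its value at
      \<open>b / 2\<close>, so the factor \<open>t\<close> gives the limit.\<close>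
    assume mono: "mono_on {0<..<b} (\<lambda>t. \<bar>w' t\<bar>)"
    show ?thesis
    proof (rule Lim_null_comparison)
      show "\<forall>\<^sub>F t in at_right 0. norm (t * w' t) \<le> t * \<bar>w' (b / 2)\<bar>"
        unfolding eventually_at_right_field
        using b(1) mono_onD[OF mono, of _ "b / 2"]
        by (intro exI[of _ "b / 2"]) (auto simp: abs_mult intro!: mult_left_mono)
      have "((\<lambda>t. t * \<bar>w' (b / 2)\<bar>) \<longlongrightarrow> 0 * \<bar>w' (b / 2)\<bar>) (at_right 0)"
        by (intro tendsto_intros)
      then show "((\<lambda>t. t * \<bar>w' (b / 2)\<bar>) \<longlongrightarrow> 0) (at_right 0)" by simp
    qed
  next
    assume mono: "mono_on {0<..<b} (\<lambda>t. - \<bar>w' t\<bar>)"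
    show ?thesis
    proof (rule Lim_null_comparison)
      \<comment> \<open>The mean value point \<open>z\<close> lies left of \<open>t\<close>, where
        the modulus of \<open>w'\<close> is at least as large; the factor \<open>2\<close> comes
        from the length \<open>t / 2\<close> of the interval.\<close>
      have "norm (t * w' t) \<le> 2 * \<bar>w t - w (t / 2)\<bar>" if t: "0 < t" "t < min b d" for t
      proof -
        obtain z where z: "t / 2 < z" "z < t" "w t - w (t / 2) = (t - t / 2) * w' z"
          using MVT2[of "t / 2" t w w'] d(2) t by auto
        have "\<bar>w' t\<bar> \<le> \<bar>w' z\<bar>" using mono_onD[OF mono, of z t] z t by auto
        then have "t * \<bar>w' t\<bar> \<le> t * \<bar>w' z\<bar>" using t by (intro mult_left_mono) auto
        also have "\<dots> = 2 * \<bar>w t - w (t / 2)\<bar>" unfolding z(3) using t by (simp add: abs_mult)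
        finally show ?thesis using t by (simp add: abs_mult)
      qed
      then show "\<forall>\<^sub>F t in at_right 0. norm (t * w' t) \<le> 2 * \<bar>w t - w (t / 2)\<bar>"
        unfolding eventually_at_right_field using b(1) d(1) by (intro exI[of _ "min b d"]) auto
      have "filterlim (\<lambda>t :: real. t / 2) (at_right 0) (at_right 0)"
        unfolding filterlim_at
        by (auto intro!: tendsto_eq_intros simp: eventually_at_right_field intro: exI[of _ 1])
      from filterlim_compose[OF w0 this]
      have "((\<lambda>t. 2 * \<bar>w t - w (t / 2)\<bar>) \<longlongrightarrow> 2 * \<bar>0 - 0\<bar>) (at_right 0)"
        by (intro tendsto_intros w0)
      then show "((\<lambda>t. 2 * \<bar>w t - w (t / 2)\<bar>) \<longlongrightarrow> 0) (at_right 0)" by simp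
    qed
  qed
qed

end

section \<open>Functions of class \<open>C\<^sup>k\<close> that are flat at given points\<close>

text \<open>All derivatives up to order \<open>k\<close>, the function itself included, vanish on \<open>Z\<close>.\<close>

primrec C_vanishing :: "nat \<Rightarrow> real set \<Rightarrow> real set \<Rightarrow> (real \<Rightarrow> real) \<Rightarrow> bool" where
  "C_vanishing 0 U Z f \<longleftrightarrow> (\<forall>z\<in>Z. f z = 0) \<and> continuous_on U f"
| "C_vanishing (Suc k) U Z f \<longleftrightarrow> (\<forall>z\<in>Z. f z = 0) \<and>
    (\<exists>f'. (\<forall>x\<in>U. (f has_real_derivative f' x) (at x)) \<and> C_vanishing k U Z f')"

lemma C_vanishing_zero: "C_vanishing k U Z f \<Longrightarrow> z \<in> Z \<Longrightarrow> f z = 0"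
  by (cases k) auto

lemma C_vanishing_continuous: "C_vanishing k U Z f \<Longrightarrow> continuous_on U f"
  by (cases k) (auto intro: DERIV_atLeastAtMost_imp_continuous_on continuous_at_imp_continuous_on DERIV_isCont)

lemma C_vanishing_Suc: "C_vanishing (Suc k) U Z f \<Longrightarrow> C_vanishing k U Z f"
proof (induction k arbitrary: f)
  case 0
  then show ?case using C_vanishing_continuous[OF 0] by simp
next
  case (Suc k)
  then obtain f' where "\<forall>x\<in>U. (f has_real_derivative f' x) (at x)" "C_vanishing (Suc k) U Z f'"
    unfolding C_vanishing.simps(2)[of "Suc k"] by blast
  then show ?case
    using Suc.IH[of f'] Suc.prems unfolding C_vanishing.simps(2)[of k U Z f] C_vanishing.simps(2)[of "Suc k"] by blast
qed

lemma C_vanishing_subset: "C_vanishing k U Z f \<Longrightarrow> V \<subseteq> U \<Longrightarrow> C_vanishing k V Z f"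
proof (induction k arbitrary: f)
  case 0
  then show ?case by (auto intro: continuous_on_subset)
next
  case (Suc k)
  then obtain f' where "\<forall>x\<in>U. (f has_real_derivative f' x) (at x)" "C_vanishing k U Z f'"
    by auto
  then show ?case
    using Suc.IH[of f'] Suc.prems unfolding C_vanishing.simps(2) by blast
qed

lemma C_vanishing_const: "C_vanishing k U {} (\<lambda>x. c)"
  by (induction k arbitrary: c) (auto intro!: exI[of _ "\<lambda>x. 0"])

lemma C_vanishing_ident: "C_vanishing k U {} (\<lambda>x. x)"
  by (cases k) (auto intro!: exI[of _ "\<lambda>x. 1"] C_vanishing_const continuous_intros)

lemma C_vanishing_add:
  "C_vanishing k U Z f \<Longrightarrow> C_vanishing k U Z g \<Longrightarrow> C_vanishing k U Z (\<lambda>x. f x + g x)"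
proof (induction k arbitrary: f g)
  case 0
  then show ?case by (auto intro: continuous_intros)
next
  case (Suc k)
  obtain f' where f': "\<And>x. x \<in> U \<Longrightarrow> (f has_real_derivative f' x) (at x)" "C_vanishing k U Z f'"
    using Suc.prems(1) by auto
  obtain g' where g': "\<And>x. x \<in> U \<Longrightarrow> (g has_real_derivative g' x) (at x)" "C_vanishing k U Z g'"
    using Suc.prems(2) by auto
  have "C_vanishing k U Z (\<lambda>x. f' x + g' x)" by (rule Suc.IH[OF f'(2) g'(2)])
  moreover have "\<forall>x\<in>U. ((\<lambda>x. f x + g x) has_real_derivative f' x + g' x) (at x)"
    using DERIV_add[OF f'(1) g'(1)] by blast
  ultimately show ?case
    using Suc.prems unfolding C_vanishing.simps(2) by (intro conjI exI[of _ "\<lambda>x. f' x + g' x"]) auto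
qed

text \<open>Each term of the Leibniz rule keeps \<open>g\<close> or a derivative of it as a factor,
  so flatness of the second factor is inherited by the product.\<close>

lemma C_vanishing_mult:
  "C_vanishing k U {} f \<Longrightarrow> C_vanishing k U Z g \<Longrightarrow> C_vanishing k U Z (\<lambda>x. f x * g x)"
proof (induction k arbitrary: f g)
  case 0
  then show ?case by (auto intro: continuous_intros)
next
  case (Suc k)
  obtain f' where f': "\<And>x. x \<in> U \<Longrightarrow> (f has_real_derivative f' x) (at x)" "C_vanishing k U {} f'"
    using Suc.prems(1) by auto
  obtain g' where g': "\<And>x. x \<in> U \<Longrightarrow> (g has_real_derivative g' x) (at x)" "C_vanishing k U Z g'"
    using Suc.prems(2) by auto
  have "C_vanishing k U Z (\<lambda>x. f' x * g x + f x * g' x)"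
    using Suc.IH[OF f'(2) C_vanishing_Suc[OF Suc.prems(2)]] Suc.IH[OF C_vanishing_Suc[OF Suc.prems(1)] g'(2)]
    by (rule C_vanishing_add)
  moreover have "\<forall>x\<in>U. ((\<lambda>x. f x * g x) has_real_derivative f' x * g x + f x * g' x) (at x)"
    using DERIV_mult'[OF f'(1) g'(1)] by (simp add: add.commute)
  ultimately show ?case
    using Suc.prems unfolding C_vanishing.simps(2)
    by (intro conjI exI[of _ "\<lambda>x. f' x * g x + f x * g' x"]) auto
qed

text \<open>The derivative is a factor \<open>g' x\<close> times a composite with outer function
  \<open>f'\<close>, so vanishing comes from the outer function and passes through
  \<open>C_vanishing_mult\<close>.\<close>

lemma C_vanishing_compose:
  assumes "C_vanishing k V {} g" "C_vanishing k U Z f" "g ` V \<subseteq> U" "g ` Y \<subseteq> Z"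
  shows "C_vanishing k V Y (\<lambda>x. f (g x))"
  using assms(1,2)
proof (induction k arbitrary: f)
  case 0
  then show ?case
    using assms(3,4) by (auto intro: continuous_on_compose2)
next
  case (Suc k)
  obtain f' where f': "\<And>x. x \<in> U \<Longrightarrow> (f has_real_derivative f' x) (at x)" "C_vanishing k U Z f'"
    using Suc.prems(2) by auto
  obtain g' where g': "\<And>x. x \<in> V \<Longrightarrow> (g has_real_derivative g' x) (at x)" "C_vanishing k V {} g'"
    using Suc.prems(1) by auto
  have "C_vanishing k V Y (\<lambda>x. g' x * f' (g x))"
    by (rule C_vanishing_mult[OF g'(2) Suc.IH[OF C_vanishing_Suc[OF Suc.prems(1)] f'(2)]])
  moreover have "\<forall>x\<in>V. ((\<lambda>x. f (g x)) has_real_derivative g' x * f' (g x)) (at x)"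
    using DERIV_chain2[OF f'(1) g'(1)] assms(3) by (auto simp: mult.commute)
  moreover have "\<forall>z\<in>Y. f (g z) = 0"
    using C_vanishing_zero[OF Suc.prems(2)] assms(4) by auto
  ultimately show ?case
    unfolding C_vanishing.simps(2) by (intro conjI exI[of _ "\<lambda>x. g' x * f' (g x)"])
qed

text \<open>The function \<open>r\<close> satisfies \<open>r' = - t * r^3\<close>, so its derivative
  is built from functions already known to be of class \<open>k\<close>.\<close>

lemma C_vanishing_inverse_sqrt: "C_vanishing k UNIV {} (\<lambda>t. inverse (sqrt (1 + t\<^sup>2)))"
proof (induction k)
  case 0
  have "1 + t\<^sup>2 \<noteq> 0" for t :: real using zero_le_power2[of t] by linarith
  then show ?case by (auto intro!: continuous_intros)
next
  case (Suc k)
  define r where "r t = inverse (sqrt (1 + t\<^sup>2))" for t :: real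
  have "C_vanishing k UNIV {} r" using Suc unfolding r_def .
  then have "C_vanishing k UNIV {} (\<lambda>t. (-1) * (t * (r t * (r t * r t))))"
    by (intro C_vanishing_mult C_vanishing_const C_vanishing_ident)
  moreover have "(r has_real_derivative (-1) * (t * (r t * (r t * r t)))) (at t)" for t
  proof -
    have pos: "0 < 1 + t\<^sup>2" using zero_le_power2[of t] by linarith
    show ?thesis
      unfolding r_def
      by (rule derivative_eq_intros refl | use pos in \<open>simp add: field_simps\<close>)+
  qed
  ultimately have "C_vanishing (Suc k) UNIV {} r"
    unfolding C_vanishing.simps(2) by (intro conjI exI[of _ "\<lambda>t. (-1) * (t * (r t * (r t * r t)))"]) auto
  then show ?case unfolding r_def .
qed

text \<open>On the whole line the derivatives postulated by \<open>C_vanishing\<close> coincide with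
  the iterates of \<open>deriv\<close>.\<close>

lemma C_vanishing_deriv_funpow:
  "C_vanishing k UNIV Z f \<Longrightarrow> j \<le> k \<Longrightarrow> C_vanishing (k - j) UNIV Z ((deriv ^^ j) f)"
proof (induction j)
  case (Suc j)
  then have "C_vanishing (Suc (k - Suc j)) UNIV Z ((deriv ^^ j) f)" by (simp add: Suc_diff_Suc)
  then obtain f' where f': "\<And>x. ((deriv ^^ j) f has_real_derivative f' x) (at x)" "C_vanishing (k - Suc j) UNIV Z f'"
    by auto
  from f'(1) have "deriv ((deriv ^^ j) f) = f'" by (auto intro: DERIV_imp_deriv)
  with f'(2) show ?case by simp
qed simp

lemma C_vanishing_imp_class_C:
  assumes "C_vanishing p UNIV Z f" shows "class_C p f"
  unfolding class_C_def
proof (intro conjI allI impI)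
  fix k x assume "k < p"
  then obtain j where "p - k = Suc j" by (metis Suc_diff_Suc)
  with C_vanishing_deriv_funpow[OF assms, of k] \<open>k < p\<close>
  show "(deriv ^^ k) f differentiable at x"
    by (auto simp: real_differentiable_def)
next
  show "continuous_on UNIV ((deriv ^^ p) f)"
    using C_vanishing_deriv_funpow[OF assms, of p] C_vanishing_continuous by auto
qed

text \<open>
  The sign \<open>c\<close> is a parameter because differentiation changes the parity of the extension; \<open>c = -1\<close>
  gives the odd one.
\<close>

definition flat_ext :: "real \<Rightarrow> nat \<Rightarrow> (real \<Rightarrow> real) \<Rightarrow> real \<Rightarrow> real" where
  "flat_ext c k w t = (if 0 < t then t ^ k * w t else if t < 0 then c * ((- t) ^ k * w (- t)) else 0)"

lemma flat_ext_tendsto_0: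
  assumes "(w \<longlongrightarrow> 0) (at_right 0)"
  shows "(flat_ext c k w \<longlongrightarrow> 0) (at 0)"
proof -
  have "((\<lambda>t. t ^ k * w t) \<longlongrightarrow> 0 ^ k * 0) (at_right 0)"
    by (intro tendsto_intros assms)
  then have *: "((\<lambda>t. t ^ k * w t) \<longlongrightarrow> 0) (at_right 0)" by simp
  have pos: "\<forall>\<^sub>F t in at_right (0::real). 0 < t" by (simp add: eventually_at_right_less)
  have "(flat_ext c k w \<longlongrightarrow> 0) (at_right 0)"
    using pos by (intro Lim_transform_eventually[OF *]) (auto simp: flat_ext_def elim: eventually_mono)
  moreover have "((\<lambda>t. flat_ext c k w (- t)) \<longlongrightarrow> c * 0) (at_right 0)"
    using pos by (intro Lim_transform_eventually[OF tendsto_mult[OF tendsto_const *]])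
      (auto simp: flat_ext_def elim: eventually_mono)
  ultimately show ?thesis
    by (simp add: filterlim_at_split filterlim_at_left_to_right)
qed

text \<open>Extracting the odd factor \<open>t\<close> changes the parity, hence the sign of
  \<open>c\<close>.\<close>

lemma flat_ext_Suc: "flat_ext c (Suc k) w t = t * flat_ext (- c) k w t"
  by (simp add: flat_ext_def)

lemma flat_ext_has_derivative:
  assumes w: "(w \<longlongrightarrow> 0) (at_right 0)"
    and der: "\<And>t. 0 < t \<Longrightarrow> t < e \<Longrightarrow> (w has_real_derivative w' t) (at t)"
    and t: "\<bar>t\<bar> < e"
  shows "(flat_ext c (Suc k) w has_real_derivative
    flat_ext (- c) k (\<lambda>t. real (Suc k) * w t + t * w' t) t) (at t)"
proof -
  have pos: "((\<lambda>t. t ^ Suc k * w t) has_real_derivative u ^ k * (real (Suc k) * w u + u * w' u)) (at u)"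
    if "0 < u" "u < e" for u
    using DERIV_mult[OF DERIV_pow[of "Suc k" u] der[OF that]] by (simp add: algebra_simps)
  show ?thesis
  proof (cases t "0 :: real" rule: linorder_cases)
    case equal
    \<comment> \<open>By \<open>flat_ext_Suc\<close> the difference quotient at \<open>0\<close> is
      \<open>flat_ext (- c) k w\<close>.\<close>
    have "((\<lambda>s. (flat_ext c (Suc k) w s - flat_ext c (Suc k) w 0) / (s - 0)) \<longlongrightarrow> 0) (at 0)"
      by (rule Lim_transform_eventually[OF flat_ext_tendsto_0[OF w, of "- c" k]])
        (auto simp: eventually_at_filter flat_ext_Suc)
    then show ?thesis
      unfolding has_field_derivative_iff equal by (simp add: flat_ext_def)
  next
    case greater
    then have "(flat_ext c (Suc k) w has_real_derivative t ^ k * (real (Suc k) * w t + t * w' t)) (at t)"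
      by (intro has_field_derivative_transform_within_open[where S = "{0<..}", OF pos])
        (use t in \<open>auto simp: flat_ext_def\<close>)
    then show ?thesis using greater by (simp add: flat_ext_def)
  next
    case less
    have "((\<lambda>t. c * ((- t) ^ Suc k * w (- t))) has_real_derivative
        c * ((- t) ^ k * (real (Suc k) * w (- t) + (- t) * w' (- t)) * (- 1))) (at t)"
      by (intro DERIV_cmult DERIV_chain2[OF pos] DERIV_minus DERIV_ident) (use less t in auto)
    then have "(flat_ext c (Suc k) w has_real_derivative
        c * ((- t) ^ k * (real (Suc k) * w (- t) + (- t) * w' (- t)) * (- 1))) (at t)"
      by (rule has_field_derivative_transform_within_open[where S = "{..<0}"])
        (use less in \<open>auto simp: flat_ext_def\<close>)
    then show ?thesis using less by (simp add: flat_ext_def)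
  qed
qed

context o_minimal_structure
begin

text \<open>Both \<open>w\<close> and \<open>c\<close> vary in the induction, since differentiation
  replaces them by \<open>Suc k * w + t * w'\<close> and \<open>- c\<close>. The radius may shrink
  at each order, because derivatives are only known to exist near \<open>0\<close>.\<close>

lemma C_vanishing_flat_ext:
  assumes "def_fun w" "(w \<longlongrightarrow> 0) (at_right 0)"
  shows "\<exists>e>0. C_vanishing k {-e<..<e} {0} (flat_ext c k w)"
  using assms
proof (induction k arbitrary: w c)
  case 0
  obtain e where e: "e > 0" "\<And>t. 0 < t \<Longrightarrow> t < e \<Longrightarrow> isCont w t"
    using continuous_germ[OF 0(1), of 0] unfolding eventually_at_right_field by blast
  have "isCont (flat_ext c 0 w) t" if t: "\<bar>t\<bar> < e" for t
  proof (cases t "0 :: real" rule: linorder_cases)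
    case equal
    then show ?thesis
      using flat_ext_tendsto_0[OF 0(2), of c 0] by (simp add: isCont_def flat_ext_def)
  next
    case greater
    have "\<forall>\<^sub>F s in nhds t. flat_ext c 0 w s = w s"
      by (rule eventually_mono[OF eventually_nhds_in_open[of "{0<..}"]]) (use greater in \<open>auto simp: flat_ext_def\<close>)
    from isCont_cong[OF this] show ?thesis using e(2)[of t] greater t by simp
  next
    case less
    have "\<forall>\<^sub>F s in nhds t. flat_ext c 0 w s = c * w (- s)"
      by (rule eventually_mono[OF eventually_nhds_in_open[of "{..<0}"]]) (use less in \<open>auto simp: flat_ext_def\<close>)
    moreover have "isCont (\<lambda>s. c * w (- s)) t"
      using isCont_o2[of t uminus w] e(2)[of "- t"] less t by (simp add: continuous_intros)
    ultimately show ?thesis by (subst isCont_cong)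
  qed
  then have "continuous_on {-e<..<e} (flat_ext c 0 w)"
    by (intro continuous_at_imp_continuous_on) auto
  then show ?case
    using e(1) by (intro exI[of _ e]) (simp add: flat_ext_def[of _ _ _ 0])
next
  case (Suc k)
  obtain w' where w': "def_fun w'" "\<forall>\<^sub>F t in at_right 0. (w has_real_derivative w' t) (at t)"
    using derivative_germ[OF Suc.prems(1)] by blast
  then obtain d where d: "d > 0" "\<And>t. 0 < t \<Longrightarrow> t < d \<Longrightarrow> (w has_real_derivative w' t) (at t)"
    unfolding eventually_at_right_field by blast
  define v where "v t = real (Suc k) * w t + t * w' t" for t
  have "def_fun v"
    unfolding def_fun_def v_def by (intro def_term_add def_term_mult def_term_app[OF Suc.prems(1)] def_term_app[OF w'(1)] def_term_var def_term_const) simp_all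
  moreover have "((\<lambda>t. real (Suc k) * w t + t * w' t) \<longlongrightarrow> real (Suc k) * 0 + 0) (at_right 0)"
    by (intro tendsto_intros Suc.prems(2) euler_derivative_tendsto_0[OF Suc.prems w'])
  then have "(v \<longlongrightarrow> 0) (at_right 0)" by (simp add: v_def[abs_def])
  ultimately obtain e where e: "e > 0" "C_vanishing k {-e<..<e} {0} (flat_ext (- c) k v)"
    using Suc.IH[of v "- c"] by blast
  define r where "r = min d e"
  have "C_vanishing k {-r<..<r} {0} (flat_ext (- c) k v)"
    by (rule C_vanishing_subset[OF e(2)]) (auto simp: r_def)
  moreover have "(flat_ext c (Suc k) w has_real_derivative flat_ext (- c) k v t) (at t)"
    if "t \<in> {-r<..<r}" for t
    unfolding v_def[abs_def]
    by (rule flat_ext_has_derivative[OF Suc.prems(2) d(2)]) (use that in \<open>auto simp: r_def\<close>)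
  moreover have "flat_ext c (Suc k) w 0 = 0" by (simp add: flat_ext_def)
  ultimately have "C_vanishing (Suc k) {-r<..<r} {0} (flat_ext c (Suc k) w)"
    unfolding C_vanishing.simps(2) by blast
  moreover have "r > 0" using d(1) e(1) by (simp add: r_def)
  ultimately show ?case by blast
qed

end

section \<open>The minorant\<close>

lemma odd_strict_monoI:
  fixes f :: "real \<Rightarrow> real"
  assumes odd: "\<And>x. f (- x) = - f x" and pos: "\<And>s t. 0 \<le> s \<Longrightarrow> s < t \<Longrightarrow> f s < f t"
  shows "strict_mono f"
proof (rule strict_monoI)
  fix s t :: real assume "s < t"
  have f0: "f 0 = 0" using odd[of 0] by simp
  consider "0 \<le> s" | "t \<le> 0" | "s < 0" "0 < t" by linarith
  then show "f s < f t"
  proof cases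
    case 1
    then show ?thesis using pos \<open>s < t\<close> by blast
  next
    case 2
    then show ?thesis using pos[of "- t" "- s"] odd \<open>s < t\<close> by simp
  next
    case 3
    then show ?thesis using pos[of 0 "- s"] pos[of 0 t] odd[of s] f0 by simp
  qed
qed

lemma odd_surjI:
  fixes f :: "real \<Rightarrow> real"
  assumes odd: "\<And>x. f (- x) = - f x" and cont: "continuous_on UNIV f"
    and unbounded: "\<And>y. 0 \<le> y \<Longrightarrow> \<exists>t\<ge>0. y \<le> f t"
  shows "surj f"
proof -
  have nonneg: "\<exists>x. f x = y" if y: "0 \<le> y" for y
  proof -
    obtain t where t: "0 \<le> t" "y \<le> f t" using unbounded[OF y] by blast
    have "f 0 = 0" using odd[of 0] by simp
    then show ?thesis
      using IVT'[of f 0 y t] t y continuous_on_subset[OF cont] by auto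
  qed
  have "\<exists>x. f x = y" for y
  proof (cases "0 \<le> y")
    case False
    then obtain x where "f x = - y" using nonneg[of "- y"] by auto
    then have "f (- x) = y" using odd by simp
    then show ?thesis ..
  qed (use nonneg in blast)
  then show ?thesis unfolding surj_def by metis
qed

text \<open>Without such a bound, points with \<open>\<bar>g\<bar>\<close> at least \<open>t\<close>
  and \<open>f\<close> tending to \<open>0\<close> would accumulate at a generalized zero of
  \<open>f\<close>, hence at a zero of \<open>g\<close>, against continuity of \<open>g\<close>. As
  \<open>f\<close> may be discontinuous, the limit is taken in the closure of its graph.\<close>

lemma compact_pos_lower_bound:
  fixes K :: "(nat \<Rightarrow> real) set" and f g :: "(nat \<Rightarrow> real) \<Rightarrow> real"
  assumes "compact K" "continuous_on K g" "gen_zeros K f \<subseteq> {x \<in> K. g x = 0}" "0 < t"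
  shows "\<exists>c>0. \<forall>x\<in>K. t \<le> \<bar>g x\<bar> \<longrightarrow> c \<le> \<bar>f x\<bar>"
proof (rule ccontr)
  assume "\<not> ?thesis"
  then have "\<exists>x\<in>K. t \<le> \<bar>g x\<bar> \<and> \<bar>f x\<bar> < inverse (real (Suc n))" for n
    by (force simp: not_le)
  then obtain x where x: "\<And>n. x n \<in> K" "\<And>n. t \<le> \<bar>g (x n)\<bar>" "\<And>n. \<bar>f (x n)\<bar> < inverse (real (Suc n))"
    by metis
  obtain l r where l: "l \<in> K" "strict_mono (r :: nat \<Rightarrow> nat)" "(x \<circ> r) \<longlonglongrightarrow> l"
    using compact_imp_seq_compact[OF assms(1)] x(1) unfolding seq_compact_def by blast
  have "(\<lambda>n. f (x n)) \<longlonglongrightarrow> 0"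
    by (rule Lim_null_comparison[OF _ LIMSEQ_inverse_real_of_nat]) (use x(3) in \<open>auto intro!: always_eventually less_imp_le simp del: of_nat_Suc\<close>)
  from LIMSEQ_subseq_LIMSEQ[OF this l(2)]
  have "(\<lambda>n. ((x \<circ> r) n, f ((x \<circ> r) n))) \<longlonglongrightarrow> (l, 0)"
    using l(3) by (intro tendsto_Pair) (simp_all add: o_def)
  then have "(l, 0) \<in> closure {(x, f x) | x. x \<in> K}"
    unfolding closure_sequential using x(1)
    by (intro exI[of _ "\<lambda>n. ((x \<circ> r) n, f ((x \<circ> r) n))"]) auto
  then have "l \<in> gen_zeros K f"
    unfolding gen_zeros_def by (intro image_eqI[of _ _ "(l, 0)"]) auto
  then have "g l = 0" using assms(3) by auto
  have "(\<lambda>n. g ((x \<circ> r) n)) \<longlonglongrightarrow> g l"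
    using continuous_on_tendsto_compose[OF assms(2) l(3,1)] x(1) by simp
  from tendsto_rabs[OF this] have "t \<le> \<bar>g l\<bar>"
    by (rule LIMSEQ_le_const) (use x(2) in auto)
  with \<open>g l = 0\<close> \<open>0 < t\<close> show False by simp
qed

section \<open>Construction of the minorant and definability of the bound\<close>

context o_minimal_structure
begin

lemma Phi_minorant:
  assumes h: "def_fun h" and pos: "\<And>t. 0 < t \<Longrightarrow> 0 < h t" and le1: "\<And>t. h t \<le> 1"
    and mono: "\<And>s t. 0 < s \<Longrightarrow> s \<le> t \<Longrightarrow> h s \<le> h t"
  shows "\<exists>\<phi>\<in>Phi p. def_fun \<phi> \<and> (\<forall>t. 0 < t \<longrightarrow> t \<le> M \<longrightarrow> \<bar>\<phi> t\<bar> \<le> h t)"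
proof -
  \<comment> \<open>The factor \<open>t\<close> forces the limit \<open>0\<close>, although
    \<open>h\<close> may have a positive limit at \<open>0\<close>.\<close>
  define w where "w t = t * h t" for t
  have w: "def_fun w"
    unfolding def_fun_def w_def by (intro def_term_mult def_term_app[OF h] def_term_var) simp_all
  have "(w \<longlongrightarrow> 0) (at_right 0)"
  proof (rule Lim_null_comparison)
    show "\<forall>\<^sub>F t in at_right 0. norm (w t) \<le> t"
      unfolding eventually_at_right_field
    proof (intro exI[of _ 1] conjI allI impI)
      fix t :: real assume "0 < t"
      then show "norm (w t) \<le> t"
        using pos[of t] le1[of t] mult_left_le[of "h t" t] by (simp add: w_def abs_mult)
    qed simp
  qed (rule tendsto_ident_at)
  then obtain e where e: "e > 0" "C_vanishing p {-e<..<e} {0} (flat_ext (-1) p w)"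
    using C_vanishing_flat_ext[OF w] by blast
  define E where "E = flat_ext (-1) p w"
  \<comment> \<open>Being less than \<open>e\<close> keeps the range of \<open>\<sigma>\<close>
    where \<open>E\<close> is smooth; being at most \<open>1\<close> yields
    \<open>\<sigma> t \<le> t\<close> and makes powers of \<open>\<sigma> t\<close> at most
    \<open>1\<close>.\<close>
  define \<delta> where "\<delta> = min 1 (e / 2)"
  have \<delta>: "0 < \<delta>" "\<delta> \<le> 1" "\<delta> < e" using e(1) by (auto simp: \<delta>_def)
  define \<rho> where "\<rho> t = inverse (sqrt (1 + t\<^sup>2))" for t :: real
  define \<sigma> where "\<sigma> t = \<delta> * (t * \<rho> t)" for t
  \<comment> \<open>Chosen so that \<open>c * (1 + t * t) \<le> 1\<close> for
    \<open>0 < t \<le> M\<close>.\<close>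
  define c where "c = inverse (1 + M * M)"
  have c: "0 < c" using zero_le_square[of M] unfolding c_def by (simp add: add_pos_nonneg)
  define \<phi> where "\<phi> t = (c * (1 + t * t)) * E (\<sigma> t)" for t
  have \<rho>_pos: "0 < \<rho> t" "\<rho> t \<le> 1" for t
    by (auto simp: \<rho>_def add_pos_nonneg inverse_le_1_iff)
  have t\<rho>: "\<bar>t * \<rho> t\<bar> < 1" for t
  proof -
    have "\<bar>t\<bar> < sqrt (1 + t\<^sup>2)" by (rule real_less_rsqrt) simp
    moreover have "0 < sqrt (1 + t\<^sup>2)" by (simp add: add_pos_nonneg)
    ultimately show ?thesis
      by (simp add: \<rho>_def abs_mult divide_inverse[symmetric] divide_less_eq)
  qed
  have \<sigma>_le: "\<bar>\<sigma> t\<bar> \<le> \<delta>" for t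
    using t\<rho>[of t] \<delta>(1) by (simp add: \<sigma>_def abs_mult mult_left_le)
  have \<sigma>_pos: "0 < \<sigma> t" "\<sigma> t \<le> t" if "0 < t" for t
  proof -
    show "0 < \<sigma> t" using that \<delta>(1) \<rho>_pos by (simp add: \<sigma>_def)
    have "t * \<rho> t \<le> t" using that \<rho>_pos[of t] by (simp add: mult_left_le)
    moreover have "\<delta> * (t * \<rho> t) \<le> t * \<rho> t"
      using that \<delta> \<rho>_pos[of t] by (intro mult_left_le_one_le) auto
    ultimately show "\<sigma> t \<le> t" by (simp add: \<sigma>_def)
  qed
  have \<sigma>_mono: "\<sigma> s < \<sigma> t" if "0 \<le> s" "s < t" for s t
  proof -
    \<comment> \<open>Squaring reduces monotonicity of \<open>s * \<rho> s\<close> to that of a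
      reciprocal.\<close>
    have "(s * \<rho> s)\<^sup>2 = 1 - inverse (1 + s\<^sup>2)" for s
    proof -
      have "1 + s\<^sup>2 \<noteq> 0" using zero_le_power2[of s] by linarith
      then show ?thesis by (simp add: \<rho>_def power_mult_distrib power_inverse field_simps)
    qed
    moreover have "inverse (1 + t\<^sup>2) < inverse (1 + s\<^sup>2)"
      using that by (intro less_imp_inverse_less) (auto simp: add_pos_nonneg power_strict_mono)
    ultimately have "(s * \<rho> s)\<^sup>2 < (t * \<rho> t)\<^sup>2" by simp
    then have "s * \<rho> s < t * \<rho> t"
      by (rule power_less_imp_less_base) (use that \<rho>_pos[of t] in auto)
    then show ?thesis using \<delta>(1) by (simp add: \<sigma>_def)
  qed
  \<comment> \<open>The exponent \<open>Suc p\<close> includes the factor \<open>t\<close> inside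
    \<open>w\<close>.\<close>
  have E_pos: "E t = t ^ Suc p * h t" if "0 < t" for t
    using that by (simp add: E_def flat_ext_def w_def)
  have E0: "E 0 = 0" by (simp add: E_def flat_ext_def)
  have E_mono: "E s < E t" if "0 \<le> s" "s < t" for s t
  proof (cases "s = 0")
    case True
    then show ?thesis using that E_pos[of t] pos[of t] E0 by simp
  next
    case False
    then have "s ^ Suc p * h s < t ^ Suc p * h t"
      using that pos[of s] mono[of s t] by (intro mult_less_le_imp_less power_strict_mono) auto
    then show ?thesis using False that E_pos by simp
  qed
  have odd: "\<phi> (- t) = - \<phi> t" for t
    by (simp add: \<phi>_def E_def flat_ext_def \<sigma>_def \<rho>_def)
  have \<sigma>0: "\<sigma> 0 = 0" by (simp add: \<sigma>_def)
  have E\<sigma>_nonneg: "0 \<le> E (\<sigma> t)" if "0 \<le> t" for t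
    using E_mono[of 0 "\<sigma> t"] \<sigma>_pos[of t] E0 \<sigma>0 that by (cases "t = 0") auto
  have incr: "\<phi> s < \<phi> t" if "0 \<le> s" "s < t" for s t
  proof -
    have "0 \<le> \<sigma> s" using \<sigma>_pos[of s] \<sigma>0 that by (cases "s = 0") auto
    then have "E (\<sigma> s) < E (\<sigma> t)" by (intro E_mono \<sigma>_mono that)
    moreover have "c * (1 + s * s) \<le> c * (1 + t * t)" using c that by (simp add: mult_mono)
    moreover have "0 < c * (1 + s * s)" using c by (simp add: add_pos_nonneg)
    ultimately show ?thesis
      unfolding \<phi>_def using E\<sigma>_nonneg[OF that(1)] by (intro mult_le_less_imp_less) auto
  qed
  have "C_vanishing p UNIV {0} (\<lambda>t. E (\<sigma> t))"
  proof (rule C_vanishing_compose[where f = E and g = \<sigma> and U = "{-e<..<e}" and Z = "{0}"])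
    show "C_vanishing p {-e<..<e} {0} E" using e(2) by (simp add: E_def)
    show "C_vanishing p UNIV {} \<sigma>"
      unfolding \<sigma>_def[abs_def] \<rho>_def
      by (intro C_vanishing_mult C_vanishing_const C_vanishing_ident C_vanishing_inverse_sqrt)
    show "\<sigma> ` UNIV \<subseteq> {-e<..<e}"
    proof
      fix y assume "y \<in> \<sigma> ` UNIV"
      then obtain t where "y = \<sigma> t" by auto
      then show "y \<in> {-e<..<e}" using \<sigma>_le[of t] \<delta>(3) by auto
    qed
  qed (simp add: \<sigma>0)
  then have C: "C_vanishing p UNIV {0} \<phi>"
    unfolding \<phi>_def[abs_def]
    by (intro C_vanishing_mult C_vanishing_add C_vanishing_const C_vanishing_ident)
  have "\<exists>t\<ge>0. y \<le> \<phi> t" if "0 \<le> y" for y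
  proof -
    \<comment> \<open>For \<open>t \<ge> 1\<close> the value \<open>\<phi> t\<close> is at least
      \<open>A * (1 + t * t)\<close>, hence at least \<open>A * t\<close>, because
      \<open>E (\<sigma> t)\<close> increases with \<open>t\<close>. The summand \<open>1\<close> in
      the witness \<open>1 + y / A\<close> ensures \<open>t \<ge> 1\<close>.\<close>
    define A where "A = c * E (\<sigma> 1)"
    have A: "0 < A" using c E_mono[of 0 "\<sigma> 1"] \<sigma>_pos(1)[of 1] E0 by (simp add: A_def)
    define t where "t = 1 + y / A"
    have t: "1 \<le> t" using A that by (simp add: t_def)
    have "y \<le> A * t" using A by (simp add: t_def field_simps)
    also have "\<dots> \<le> A * (1 + t * t)"
    proof (rule mult_left_mono)
      have "t * 1 \<le> t * t" using t by (intro mult_left_mono) auto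
      then show "t \<le> 1 + t * t" by simp
    qed (use A in simp)
    also have "\<dots> = (c * (1 + t * t)) * E (\<sigma> 1)" by (simp add: A_def)
    also have "\<dots> \<le> \<phi> t"
    proof -
      have "E (\<sigma> 1) \<le> E (\<sigma> t)"
        using E_mono[of "\<sigma> 1" "\<sigma> t"] \<sigma>_mono[of 1 t] \<sigma>_pos(1)[of 1] t by (cases "t = 1") auto
      then show ?thesis
        unfolding \<phi>_def using c by (intro mult_left_mono) (auto simp: add_nonneg_nonneg)
    qed
    finally show ?thesis using t by (intro exI[of _ t]) simp
  qed
  then have surj: "surj \<phi>"
    by (intro odd_surjI odd C_vanishing_continuous[OF C])
  have sm: "strict_mono \<phi>"
    by (intro odd_strict_monoI odd incr)
  then have "bij \<phi>"
    using surj strict_mono_imp_inj_on[OF sm] by (simp add: bij_def)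
  moreover have "(deriv ^^ k) \<phi> 0 = 0" if "k \<in> {1..p}" for k
    using C_vanishing_zero[OF C_vanishing_deriv_funpow[OF C, of k]] that by simp
  ultimately have "\<phi> \<in> Phi p"
    using odd sm C_vanishing_imp_class_C[OF C] by (simp add: Phi_def)
  moreover have "def_fun \<phi>"
  proof -
    have E: "def_fun E"
      unfolding def_fun_def E_def flat_ext_def
      by (intro def_term_If def_pred_less def_term_mult def_term_power def_term_minus def_term_app[OF w] def_term_var def_term_const) simp_all
    have \<rho>: "def_fun \<rho>"
    proof (rule def_funI)
      \<comment> \<open>Positivity and a polynomial equation single out \<open>\<rho>\<close>, which
        eliminates the square root.\<close>
      have "def_pred 2 (\<lambda>x. 0 < x 1 \<and> x 1 * x 1 * (1 + x 0 * x 0) = 1)"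
        by (intro def_pred_conj def_pred_less def_pred_eq def_term_mult def_term_add def_term_var def_term_const) simp_all
      moreover have "0 < y \<and> y * y * (1 + t * t) = 1 \<longleftrightarrow> y = \<rho> t" for t y
      proof
        assume y: "0 < y \<and> y * y * (1 + t * t) = 1"
        have "y * sqrt (1 + t\<^sup>2) = sqrt (y * y * (1 + t * t))"
          using conjunct1[OF y] by (simp add: real_sqrt_mult power2_eq_square)
        also have "\<dots> = 1" using y by simp
        finally have "y * sqrt (1 + t\<^sup>2) = 1" .
        then show "y = \<rho> t"
          unfolding \<rho>_def using inverse_unique[of "sqrt (1 + t\<^sup>2)" y] by (simp add: mult.commute)
      next
        assume "y = \<rho> t"
        have "0 < 1 + t\<^sup>2" by (simp add: add_pos_nonneg)
        then have "(\<rho> t)\<^sup>2 * (1 + t\<^sup>2) = 1" by (simp add: \<rho>_def power_inverse)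
        then show "0 < y \<and> y * y * (1 + t * t) = 1"
          using \<rho>_pos \<open>y = \<rho> t\<close> by (simp add: power2_eq_square)
      qed
      ultimately show "def_pred 2 (\<lambda>x. x 1 = \<rho> (x 0))" by simp
    qed
    show ?thesis
      unfolding def_fun_def \<phi>_def \<sigma>_def
      by (intro def_term_mult def_term_add def_term_app[OF E] def_term_app[OF \<rho>] def_term_var def_term_const) simp_all
  qed
  moreover have "\<bar>\<phi> t\<bar> \<le> h t" if t: "0 < t" "t \<le> M" for t
  proof -
    have s: "0 < \<sigma> t" "\<sigma> t \<le> t" "\<sigma> t \<le> 1"
      using \<sigma>_pos[OF t(1)] \<sigma>_le[of t] \<delta>(2) by auto
    \<comment> \<open>The power in \<open>E_pos\<close> has base at most \<open>1\<close>, so it can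
      only lower \<open>h (\<sigma> t)\<close>; monotonicity of \<open>h\<close> and
      \<open>\<sigma> t \<le> t\<close> then lead to \<open>h t\<close>.\<close>
    have "E (\<sigma> t) \<le> h (\<sigma> t)"
      using E_pos[OF s(1)] power_le_one[of "\<sigma> t" "Suc p"] s pos[OF s(1)]
      by (simp only: mult_left_le_one_le less_imp_le zero_le_power)
    also have "\<dots> \<le> h t" by (rule mono[OF s(1,2)])
    finally have "E (\<sigma> t) \<le> h t" .
    moreover have "c * (1 + t * t) \<le> 1"
    proof -
      have "c * (1 + t * t) \<le> c * (1 + M * M)"
        using c t by (intro mult_left_mono add_left_mono mult_mono) auto
      also have "\<dots> = 1"
      proof -
        have "1 + M * M \<noteq> 0" using zero_le_square[of M] by linarith
        then show ?thesis by (simp add: c_def)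
      qed
      finally show ?thesis .
    qed
    moreover have "0 \<le> c * (1 + t * t)" using c by (simp add: add_nonneg_nonneg)
    moreover have "0 \<le> E (\<sigma> t)" using E\<sigma>_nonneg t by simp
    ultimately have "\<bar>\<phi> t\<bar> = c * (1 + t * t) * E (\<sigma> t)" "c * (1 + t * t) * E (\<sigma> t) \<le> E (\<sigma> t)"
      unfolding \<phi>_def by (auto intro: mult_left_le_one_le mult_nonneg_nonneg abs_of_nonneg simp del: abs_mult)
    with \<open>E (\<sigma> t) \<le> h t\<close> show ?thesis by linarith
  qed
  ultimately show ?thesis by blast
qed

text \<open>Predicates see arbitrary assignments, whereas points of \<open>K\<close> are
  \<open>undefined\<close> from coordinate \<open>m\<close> on; \<open>restrict\<close> passes from
  the former to the latter.\<close>

lemma def_pred_graph: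
  assumes "definable_fun S m K f"
  shows "def_pred (Suc m) (\<lambda>x. restrict x {..<m} \<in> K \<and> x m = f (restrict x {..<m}))"
proof -
  have K: "K \<subseteq> euclid m" and G: "{x(m := f x) | x. x \<in> K} \<in> S (Suc m)"
    using assms by (auto simp: definable_fun_def)
  have "{x(m := f x) | x. x \<in> K} =
    {x \<in> euclid (Suc m). restrict x {..<m} \<in> K \<and> x m = f (restrict x {..<m})}"
  proof (intro equalityI subsetI)
    fix z assume "z \<in> {x(m := f x) | x. x \<in> K}"
    then obtain x where x: "x \<in> K" "z = x(m := f x)" by auto
    then have "x \<in> euclid m" using K by auto
    then have "restrict z {..<m} = x" "z \<in> euclid (Suc m)"
      using x(2) by (auto simp: euclid_iff fun_eq_iff)
    then show "z \<in> {x \<in> euclid (Suc m). restrict x {..<m} \<in> K \<and> x m = f (restrict x {..<m})}"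
      using x by simp
  next
    fix z assume z: "z \<in> {x \<in> euclid (Suc m). restrict x {..<m} \<in> K \<and> x m = f (restrict x {..<m})}"
    then have "z = (restrict z {..<m})(m := f (restrict z {..<m}))"
      by (auto simp: euclid_iff fun_eq_iff)
    then show "z \<in> {x(m := f x) | x. x \<in> K}" using z by blast
  qed
  moreover have "depends (Suc m) (\<lambda>x. restrict x {..<m} \<in> K \<and> x m = f (restrict x {..<m}))"
    unfolding depends_def
  proof (intro allI impI)
    fix x y :: "nat \<Rightarrow> real" assume xy: "\<forall>i<Suc m. x i = y i"
    then have "restrict x {..<m} = restrict y {..<m}" by (auto simp: fun_eq_iff)
    with xy show "(restrict x {..<m} \<in> K \<and> x m = f (restrict x {..<m})) =
      (restrict y {..<m} \<in> K \<and> y m = f (restrict y {..<m}))" by simp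
  qed
  ultimately show ?thesis using G by (simp add: def_pred_def)
qed

text \<open>Coordinates \<open>0\<close> and \<open>1\<close> hold the two values and the next
  \<open>m\<close> the point \<open>y\<close>, which is projected away.\<close>

lemma def_pred_joint_image:
  assumes f: "definable_fun S m K f" and g: "definable_fun S m K g"
  shows "def_pred 2 (\<lambda>x. \<exists>y\<in>K. x 0 = g y \<and> x 1 = f y)"
proof -
  define R where "R z = restrict (\<lambda>j. z (2 + j)) {..<m}" for z :: "nat \<Rightarrow> real"
  have graph: "def_pred (2 + m) (\<lambda>z. R z \<in> K \<and> z i = q (R z))"
    if "definable_fun S m K q" "i < 2" for q i
  proof -
    \<comment> \<open>The renaming puts the point behind the two values and sends the value
      coordinate \<open>m\<close> of the graph to \<open>i\<close>.\<close>
    have "restrict (\<lambda>j. z (if j < m then 2 + j else i)) {..<m} = R z" for z :: "nat \<Rightarrow> real"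
      by (auto simp: R_def fun_eq_iff)
    then show ?thesis
      using def_pred_rename[OF def_pred_graph[OF that(1)], of "\<lambda>j. if j < m then 2 + j else i" "2 + m"] that(2) by simp
  qed
  have "def_pred 2 (\<lambda>x. \<exists>z. (\<forall>i<2. z i = x i) \<and> (R z \<in> K \<and> z 0 = g (R z)) \<and> (R z \<in> K \<and> z 1 = f (R z)))"
    by (rule def_pred_exs[where k = m], intro def_pred_conj[OF graph graph] f g) simp_all
  moreover have "(\<exists>z. (\<forall>i<2. z i = x i) \<and> (R z \<in> K \<and> z 0 = g (R z)) \<and> (R z \<in> K \<and> z 1 = f (R z)))
      \<longleftrightarrow> (\<exists>y\<in>K. x 0 = g y \<and> x 1 = f y)" for x
  proof
    assume "\<exists>z. (\<forall>i<2. z i = x i) \<and> (R z \<in> K \<and> z 0 = g (R z)) \<and> (R z \<in> K \<and> z 1 = f (R z))"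
    then obtain z where "\<forall>i<2. z i = x i" "R z \<in> K" "z 0 = g (R z)" "z 1 = f (R z)" by blast
    then show "\<exists>y\<in>K. x 0 = g y \<and> x 1 = f y" by (intro bexI[of _ "R z"]) auto
  next
    assume "\<exists>y\<in>K. x 0 = g y \<and> x 1 = f y"
    then obtain y where y: "y \<in> K" "x 0 = g y" "x 1 = f y" by auto
    define z where "z i = (if i < 2 then x i else y (i - 2))" for i
    have "y \<in> euclid m" using y(1) f by (auto simp: definable_fun_def)
    then have "R z = y" by (auto simp: R_def z_def euclid_iff fun_eq_iff)
    then show "\<exists>z. (\<forall>i<2. z i = x i) \<and> (R z \<in> K \<and> z 0 = g (R z)) \<and> (R z \<in> K \<and> z 1 = f (R z))"
      using y by (intro exI[of _ z]) (auto simp: z_def)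
  qed
  ultimately show ?thesis by simp
qed

text \<open>The infimum is first order as greatest lower bound. The inserted \<open>1\<close> keeps
  the set nonempty.\<close>

lemma def_fun_level_Inf:
  assumes "definable_fun S m K f" "definable_fun S m K g"
  shows "def_fun (\<lambda>t. Inf (insert 1 {\<bar>f x\<bar> | x. x \<in> K \<and> t \<le> \<bar>g x\<bar>}))"
proof (rule def_funI)
  \<comment> \<open>The quantifiers run over real values \<open>u\<close> and \<open>v\<close>;
    points of \<open>K\<close> occur only through the joint image of \<open>g\<close> and
    \<open>f\<close>, which is definable.\<close>
  define LB where "LB t y \<longleftrightarrow> y \<le> 1 \<and>
    (\<forall>u v. (\<exists>x\<in>K. u = g x \<and> v = f x) \<longrightarrow> t \<le> \<bar>u\<bar> \<longrightarrow> y \<le> \<bar>v\<bar>)" for t y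
  have def_pred_LB: "def_pred 2 (\<lambda>x. LB (x 0) (x 1))"
    unfolding LB_def
    by (intro def_pred_conj def_pred_all def_pred_imp def_pred_le def_term_abs def_term_var def_term_const
        def_pred_rel2[of "\<lambda>u v. \<exists>x\<in>K. u = g x \<and> v = f x", OF def_pred_joint_image[OF assms]]) simp_all
  have "def_pred 2 (\<lambda>x. LB (x 0) (x 1) \<and> (\<forall>z. LB (x 0) z \<longrightarrow> z \<le> x 1))"
    by (intro def_pred_conj def_pred_all def_pred_imp def_pred_le def_term_var def_pred_rel2[of LB, OF def_pred_LB]) simp_all
  moreover have "LB t y \<and> (\<forall>z. LB t z \<longrightarrow> z \<le> y) \<longleftrightarrow>
      y = Inf (insert 1 {\<bar>f x\<bar> | x. x \<in> K \<and> t \<le> \<bar>g x\<bar>})" for t y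
  proof -
    define A where "A = insert 1 {\<bar>f x\<bar> | x. x \<in> K \<and> t \<le> \<bar>g x\<bar>}"
    have LB: "LB t z \<longleftrightarrow> (\<forall>a\<in>A. z \<le> a)" for z
      unfolding LB_def A_def by auto
    have "bdd_below A" by (rule bdd_belowI[of _ 0]) (auto simp: A_def)
    then have "LB t (Inf A)" by (simp add: LB cInf_lower)
    moreover have "z \<le> Inf A" if "LB t z" for z
      using that by (intro cInf_greatest) (auto simp: A_def LB)
    ultimately have "LB t y \<and> (\<forall>z. LB t z \<longrightarrow> z \<le> y) \<longleftrightarrow> y = Inf A"
      using order_antisym[of y "Inf A"] by blast
    then show ?thesis unfolding A_def .
  qed
  ultimately show "def_pred 2 (\<lambda>x. x 1 = Inf (insert 1 {\<bar>f y\<bar> | y. y \<in> K \<and> x 0 \<le> \<bar>g y\<bar>}))" by (simp only:)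
qed

end

theorem theorem3p5:
  fixes S :: "nat \<Rightarrow> (nat \<Rightarrow> real) set set"
    and p m :: nat
    and K :: "(nat \<Rightarrow> real) set"
    and f g :: "(nat \<Rightarrow> real) \<Rightarrow> real"
  assumes "o_minimal_structure S"
    and "p \<ge> 1"
    and "K \<subseteq> euclid m"
    and "K \<noteq> {}"
    and "compact K"
    and "definable_fun S m K f"
    and "definable_fun S m K g"
    and "continuous_on K g"
    and "gen_zeros K f \<subseteq> {x \<in> K. g x = 0}"
  shows "\<exists>\<phi> \<in> Phi p. definable_real_fun S \<phi> \<and> (\<forall>x\<in>K. \<bar>\<phi> (g x)\<bar> \<le> \<bar>f x\<bar>)"
proof -
  interpret o_minimal_structure S by fact
  define A where "A t = insert 1 {\<bar>f x\<bar> | x. x \<in> K \<and> t \<le> \<bar>g x\<bar>}" for t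
  define h where "h t = Inf (A t)" for t
  have bdd: "bdd_below (A t)" for t by (rule bdd_belowI[of _ 0]) (auto simp: A_def)
  have h: "def_fun h"
    using def_fun_level_Inf[OF assms(6,7)] by (simp add: h_def[abs_def] A_def)
  have h_pos: "0 < h t" if t: "0 < t" for t
  proof -
    obtain c where c: "c > 0" "\<And>x. x \<in> K \<Longrightarrow> t \<le> \<bar>g x\<bar> \<Longrightarrow> c \<le> \<bar>f x\<bar>"
      using compact_pos_lower_bound[OF assms(5,8,9) t] by blast
    have "min 1 c \<le> h t"
      unfolding h_def by (rule cInf_greatest) (use c(2) in \<open>auto simp: A_def min_le_iff_disj\<close>)
    with c(1) show ?thesis by linarith
  qed
  have h_le: "h t \<le> a" if "a \<in> A t" for t a
    unfolding h_def using that bdd by (rule cInf_lower)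
  \<comment> \<open>Raising the level shrinks the set and so raises its infimum.\<close>
  have h_mono: "h s \<le> h t" if "s \<le> t" for s t
    unfolding h_def by (rule cInf_superset_mono) (use that bdd in \<open>auto simp: A_def\<close>)
  have "compact ((\<lambda>x. \<bar>g x\<bar>) ` K)"
    by (intro compact_continuous_image continuous_intros assms)
  then obtain M where M: "\<And>x. x \<in> K \<Longrightarrow> \<bar>g x\<bar> \<le> M"
    using bounded_imp_bdd_above[OF compact_imp_bounded] by (force simp: bdd_above_def)
  obtain \<phi> where \<phi>: "\<phi> \<in> Phi p" "def_fun \<phi>" "\<And>t. 0 < t \<Longrightarrow> t \<le> M \<Longrightarrow> \<bar>\<phi> t\<bar> \<le> h t"
    using Phi_minorant[OF h h_pos _ h_mono, of p M] h_le[of 1] by (auto simp: A_def)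
  have odd: "\<phi> (- t) = - \<phi> t" for t using \<phi>(1) by (simp add: Phi_def)
  have "\<bar>\<phi> (g x)\<bar> \<le> \<bar>f x\<bar>" if x: "x \<in> K" for x
  proof (cases "g x = 0")
    \<comment> \<open>The bound by \<open>h\<close> concerns positive arguments; at zeros of
      \<open>g\<close>, oddness gives \<open>\<phi> 0 = 0\<close>.\<close>
    case True
    then show ?thesis using odd[of 0] by simp
  next
    case False
    have "\<bar>\<phi> (g x)\<bar> = \<bar>\<phi> \<bar>g x\<bar>\<bar>" using odd[of "g x"] by (simp add: abs_if)
    also have "\<dots> \<le> h \<bar>g x\<bar>" using \<phi>(3)[of "\<bar>g x\<bar>"] M[OF x] False by simp
    \<comment> \<open>The point \<open>x\<close> lies in its own level set, so
      \<open>\<bar>f x\<bar>\<close> is among the values in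
      \<open>A \<bar>g x\<bar>\<close>.\<close>
    also have "\<dots> \<le> \<bar>f x\<bar>" by (rule h_le) (use x in \<open>auto simp: A_def\<close>)
    finally show ?thesis .
  qed
  with \<phi>(1,2) show ?thesis using def_fun_iff by blast
qed

end
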